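(* Let $A$ be a formula with $\dim[\![A]\!]\ge2$, and let $S,T\in\{0,1\}^*$ with $S\ne T$. The denotations $[\![\underline{S}_A]\!],[\![\underline{T}_A]\!]$ are linearly independent in $[\![\mathbf{bint}_A]\!]$.
   Context: $k$ is an algebraically closed field of characteristic zero. Formulas are those of propositional intuitionistic linear logic with connectives $\otimes,\&,\multimap,!$. The *Sweedler semantics* $[\![-]\!]$: chosen vector spaces for atoms, $[\![A\otimes B]\!]=[\![A]\!]\otimes[\![B]\!]$, $[\![A\&B]\!]=[\![A]\!]\oplus[\![B]\!]$, $[\![A\multimap B]\!]=\mathrm{Hom}_k([\![A]\!],[\![B]\!])$, $[\![!A]\!]={!}[\![A]\!]$, where $!V$ is the universal (cofree) cocommutative coassociative counital coalgebra with universal linear map $d:{!}V\to V$. Proofs denote linear maps in the standard way: dereliction is $d$, contraction is comultiplication, weakening is the counit, promotion is the unique lift to a coalgebra morphism, cut is composition; a proof of $\vdash B$ denotes an element of $[\![B]\!]$. For $P\in V$, $|\emptyset\rangle_P\in{!}V$ is the unique group-like element with $d|\emptyset\rangle_P=P$. With $E=A\multimap A$, $\mathbf{bint}_A={!}E\multimap({!}E\multimap E)$. For $S=s_1\cdots s_l\in\{0,1\}^*$, the binary integer $\underline{S}_A$ is the proof of $\mathbf{bint}_A$ given by the term $\lambda!u_0.\lambda!u_1.\lambda a.\,u_{s_l}(\cdots u_{s_1}(a)\cdots)$ (each occurrence derelicted, occurrences of each $u_i$ contracted together, weakening if there are none). Its denotation is regarded as a linear map ${!}V\otimes{!}V\to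 V$, $V=\mathrm{End}_k([\![A]\!])$, sending $|\emptyset\rangle_{\alpha_0}\otimes|\emptyset\rangle_{\alpha_1}$ to $\alpha_{s_l}\circ\cdots\circ\alpha_{s_1}$. *)

theory Defs
  imports
    "HOL-Computational_Algebra.Polynomial"
    "HOL-Library.Function_Algebras"
    "HOL-Library.Product_Plus"
begin

section \<open>Linear and multilinear maps between subspaces\<close>

text \<open>
  Vector spaces are subspaces (in the sense of \<^const>\<open>module.subspace\<close>) of an ambient
  vector space, whose scalar multiplication is passed as an explicit argument.  The
  ambient addition is that of the type class; functions and pairs carry the pointwise
  vector space structure.
\<close>

definition fun_scale :: "('k \<Rightarrow> 'b \<Rightarrow> 'b) \<Rightarrow> 'k \<Rightarrow> ('a \<Rightarrow> 'b) \<Rightarrow> 'a \<Rightarrow> 'b" where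
  "fun_scale s c f = (\<lambda>x. s c (f x))"

definition prod_scale :: "('k \<Rightarrow> 'a \<Rightarrow> 'a) \<Rightarrow> ('k \<Rightarrow> 'b \<Rightarrow> 'b) \<Rightarrow> 'k \<Rightarrow> 'a \<times> 'b \<Rightarrow> 'a \<times> 'b" where
  "prod_scale s1 s2 c p = (s1 c (fst p), s2 c (snd p))"

definition linear_on ::
  "('k \<Rightarrow> 'a \<Rightarrow> 'a) \<Rightarrow> ('k \<Rightarrow> 'b \<Rightarrow> 'b) \<Rightarrow> 'a::ab_group_add set \<Rightarrow> ('a \<Rightarrow> 'b::ab_group_add) \<Rightarrow> bool" where
  "linear_on s1 s2 V f \<longleftrightarrow>
     (\<forall>x\<in>V. \<forall>y\<in>V. f (x + y) = f x + f y) \<and> (\<forall>c. \<forall>x\<in>V. f (s1 c x) = s2 c (f x))"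

text \<open>A linear map out of a subspace is represented by the function that vanishes elsewhere.\<close>

definition hom_space ::
  "('k \<Rightarrow> 'a \<Rightarrow> 'a) \<Rightarrow> ('k \<Rightarrow> 'b \<Rightarrow> 'b) \<Rightarrow> 'a::ab_group_add set \<Rightarrow> 'b::ab_group_add set \<Rightarrow> ('a \<Rightarrow> 'b) set" where
  "hom_space s1 s2 V W =
     {f. linear_on s1 s2 V f \<and> f ` V \<subseteq> W \<and> (\<forall>x. x \<notin> V \<longrightarrow> f x = 0)}"

definition linear_iso ::
  "('k \<Rightarrow> 'a \<Rightarrow> 'a) \<Rightarrow> ('k \<Rightarrow> 'b \<Rightarrow> 'b) \<Rightarrow> 'a::ab_group_add set \<Rightarrow> 'b::ab_group_add set \<Rightarrow> ('a \<Rightarrow> 'b) \<Rightarrow> bool" where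
  "linear_iso s1 s2 V W f \<longleftrightarrow> linear_on s1 s2 V f \<and> bij_betw f V W"

definition multilinear_on ::
  "('k \<Rightarrow> 'a \<Rightarrow> 'a) \<Rightarrow> ('k \<Rightarrow> 'b \<Rightarrow> 'b) \<Rightarrow> 'a::ab_group_add set list \<Rightarrow> ('a list \<Rightarrow> 'b::ab_group_add) \<Rightarrow> bool" where
  "multilinear_on s1 s2 Vs f \<longleftrightarrow>
     (\<forall>vs\<in>listset Vs. \<forall>i<length Vs. linear_on s1 s2 (Vs ! i) (\<lambda>x. f (vs[i := x])))"


section \<open>Tensor products\<close>

text \<open>
  The tensor product of a list of vector spaces is realised inside the dual of the space
  of multilinear forms: the pure tensor of a list of vectors is evaluation at that list,
  and the tensor product is the span of the pure tensors.  The empty tensor product is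
  the ground field.  The universal property is lemma \<open>tensor_universal\<close> below.
\<close>

type_synonym ('k, 'a) tensor = "('a list \<Rightarrow> 'k) \<Rightarrow> 'k"

abbreviation tensor_scale :: "'k::field \<Rightarrow> ('k, 'a) tensor \<Rightarrow> ('k, 'a) tensor" where
  "tensor_scale \<equiv> fun_scale (*)"

definition pure_tensor ::
  "('k::field \<Rightarrow> 'a \<Rightarrow> 'a) \<Rightarrow> 'a::ab_group_add set list \<Rightarrow> 'a list \<Rightarrow> ('k, 'a) tensor" where
  "pure_tensor s Vs vs = (\<lambda>m. if multilinear_on s (*) Vs m then m vs else 0)"

definition tensor_space ::
  "('k::field \<Rightarrow> 'a \<Rightarrow> 'a) \<Rightarrow> 'a::ab_group_add set list \<Rightarrow> ('k, 'a) tensor set" where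
  "tensor_space s Vs = module.span tensor_scale (pure_tensor s Vs ` listset Vs)"

text \<open>The linear map on a tensor product determined by a multilinear map \<open>f\<close>.\<close>

definition is_tensor_lift ::
  "('k::field \<Rightarrow> 'a \<Rightarrow> 'a) \<Rightarrow> ('k \<Rightarrow> 'b \<Rightarrow> 'b) \<Rightarrow> 'a::ab_group_add set list \<Rightarrow>
    ('a list \<Rightarrow> 'b::ab_group_add) \<Rightarrow> (('k, 'a) tensor \<Rightarrow> 'b) \<Rightarrow> bool" where
  "is_tensor_lift s1 s2 Vs f g \<longleftrightarrow>
     g \<in> hom_space tensor_scale s2 (tensor_space s1 Vs) UNIV \<and>
     (\<forall>vs\<in>listset Vs. g (pure_tensor s1 Vs vs) = f vs)"

definition tensor_lift ::
  "('k::field \<Rightarrow> 'a \<Rightarrow> 'a) \<Rightarrow> ('k \<Rightarrow> 'b \<Rightarrow> 'b) \<Rightarrow> 'a::ab_group_add set list \<Rightarrow>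
    ('a list \<Rightarrow> 'b::ab_group_add) \<Rightarrow> ('k, 'a) tensor \<Rightarrow> 'b" where
  "tensor_lift s1 s2 Vs f = (THE g. is_tensor_lift s1 s2 Vs f g)"

lemma vector_space_fun_scale:
  assumes "vector_space s"
  shows "vector_space (fun_scale s)"
proof -
  interpret vector_space s by fact
  show ?thesis
    by unfold_locales
      (auto simp: fun_scale_def plus_fun_def scale_right_distrib scale_left_distrib)
qed

lemma separating_functional:
  fixes s :: "'k::field \<Rightarrow> 'b::ab_group_add \<Rightarrow> 'b"
  assumes "vector_space s" and "w \<noteq> 0"
  obtains l where "linear_on s (*) UNIV l" and "l w \<noteq> 0"
proof -
  interpret vector_space s by fact
  have ind: "independent {w}" using assms(2) by simp
  define B where "B = extend_basis {w}"
  have B: "independent B" "span B = UNIV" "w \<in> B"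
    using independent_extend_basis[OF ind] span_extend_basis[OF ind]
      extend_basis_superset[OF ind] by (auto simp: B_def)
  define l where "l = (\<lambda>v. representation B v w)"
  have "linear_on s (*) UNIV l"
    unfolding linear_on_def l_def
    by (auto simp: representation_add[OF B(1)] representation_scale[OF B(1)] B(2))
  moreover have "l w \<noteq> 0"
    unfolding l_def using representation_basis[OF B(1) B(3)] by simp
  ultimately show ?thesis using that by blast
qed

lemma tensor_universal:
  fixes s1 :: "'k::field \<Rightarrow> 'a::ab_group_add \<Rightarrow> 'a" and s2 :: "'k \<Rightarrow> 'b::ab_group_add \<Rightarrow> 'b"
  assumes "vector_space s2" and f: "multilinear_on s1 s2 Vs f"
  shows "\<exists>!g. is_tensor_lift s1 s2 Vs f g"
proof -
  interpret W: vector_space s2 by fact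
  interpret T: vector_space "tensor_scale :: 'k \<Rightarrow> ('k, 'a) tensor \<Rightarrow> _"
    by (intro vector_space_fun_scale) (unfold_locales, auto simp: algebra_simps)
  let ?T = "tensor_space s1 Vs"
  let ?P = "\<lambda>t w. \<forall>l. linear_on s2 (*) UNIV l \<longrightarrow> t (l \<circ> f) = l w"
  have sub: "T.subspace ?T" by (simp add: tensor_space_def)
  have comp: "multilinear_on s1 (*) Vs (l \<circ> f)" if "linear_on s2 (*) UNIV l" for l
    using f that unfolding multilinear_on_def linear_on_def by auto
  have P_pure: "?P (pure_tensor s1 Vs vs) (f vs)" for vs
    using comp by (auto simp: pure_tensor_def)
  have P_add: "?P (t + t') (w + w')" if "?P t w" "?P t' w'" for t t' w w'
    using that by (auto simp: linear_on_def plus_fun_def)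
  have P_scale: "?P (tensor_scale c t) (s2 c w)" if "?P t w" for c t w
    using that by (auto simp: linear_on_def fun_scale_def)
  have P_unique: "w = w'" if "?P t w" "?P t w'" for t w w'
  proof (rule ccontr)
    assume "w \<noteq> w'"
    then obtain l where l: "linear_on s2 (*) UNIV l" "l (w - w') \<noteq> 0"
      using separating_functional[OF assms(1), of "w - w'"] by auto
    have "l w = l ((w - w') + w')" by simp
    also have "\<dots> = l (w - w') + l w'" using l(1) unfolding linear_on_def by blast
    finally show False using l that by auto
  qed
  have P_ex: "\<exists>w. ?P t w" if "t \<in> ?T" for t
    using that unfolding tensor_space_def
  proof (induction rule: T.span_induct_alt)
    case base
    have "l 0 = 0" if "linear_on s2 (*) UNIV l" for l
    proof -
      have "l (0 + 0) = l 0 + l 0" using that unfolding linear_on_def by blast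
      then have "l 0 + l 0 = l 0 + 0" by simp
      then show ?thesis by (simp only: add_left_cancel)
    qed
    then show ?case by (intro exI[of _ 0]) (auto simp: zero_fun_def)
  next
    case (step c x y)
    then show ?case using P_add P_scale P_pure by blast
  qed
  define g where "g = (\<lambda>t. if t \<in> ?T then (THE w. ?P t w) else 0)"
  have gP: "?P t (g t)" if "t \<in> ?T" for t
  proof -
    have "\<exists>!w. ?P t w" using P_ex[OF that] P_unique by blast
    from theI'[OF this] show ?thesis using that by (simp add: g_def)
  qed
  have geq: "g t = w" if "t \<in> ?T" "?P t w" for t w
    using gP[OF that(1)] that(2) P_unique by blast
  have pureT: "pure_tensor s1 Vs vs \<in> ?T" if "vs \<in> listset Vs" for vs
    unfolding tensor_space_def using that by (intro T.span_base) auto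
  have "is_tensor_lift s1 s2 Vs f g"
    unfolding is_tensor_lift_def hom_space_def linear_on_def
  proof (intro conjI CollectI ballI allI impI)
    show "g (x + y) = g x + g y" if "x \<in> ?T" "y \<in> ?T" for x y
      using that by (intro geq P_add gP T.subspace_add[OF sub])
    show "g (tensor_scale c x) = s2 c (g x)" if "x \<in> ?T" for c x
      using that by (intro geq P_scale gP T.subspace_scale[OF sub])
    show "g (pure_tensor s1 Vs vs) = f vs" if "vs \<in> listset Vs" for vs
      using that by (intro geq P_pure pureT)
  qed (auto simp: g_def)
  moreover have "h = g" if h: "is_tensor_lift s1 s2 Vs f h" for h
  proof
    fix t
    have add: "h (x + y) = h x + h y" if "x \<in> ?T" "y \<in> ?T" for x y
      using h that unfolding is_tensor_lift_def hom_space_def linear_on_def by auto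
    have scale: "h (tensor_scale c x) = s2 c (h x)" if "x \<in> ?T" for c x
      using h that unfolding is_tensor_lift_def hom_space_def linear_on_def by auto
    have pure: "h (pure_tensor s1 Vs vs) = f vs" if "vs \<in> listset Vs" for vs
      using h that unfolding is_tensor_lift_def by auto
    have "?P t (h t)" if "t \<in> ?T"
    proof -
      have "t \<in> ?T \<and> ?P t (h t)"
        using that unfolding tensor_space_def
      proof (induction rule: T.span_induct_alt)
        case base
        have "h 0 = s2 0 (h 0)"
          using scale[of 0 0] T.subspace_0[OF sub] by simp
        then have "h 0 = 0" by simp
        moreover have "l 0 = 0" if "linear_on s2 (*) UNIV l" for l
        proof -
          have "l (0 + 0) = l 0 + l 0" using that unfolding linear_on_def by blast
          then have "l 0 + l 0 = l 0 + 0" by simp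
          then show ?thesis by (simp only: add_left_cancel)
        qed
        ultimately show ?case
          using T.span_zero by (auto simp: zero_fun_def)
      next
        case (step c x y)
        then obtain vs where vs: "vs \<in> listset Vs" "x = pure_tensor s1 Vs vs" by auto
        have x: "x \<in> ?T" "?P x (h x)" using vs pureT pure P_pure by auto
        have y: "y \<in> ?T" "?P y (h y)" using step(2) unfolding tensor_space_def by blast+
        have cx: "tensor_scale c x \<in> ?T" using x sub by (simp add: T.subspace_scale)
        have "h (tensor_scale c x + y) = s2 c (h x) + h y"
          using add[OF cx y(1)] scale[OF x(1)] by simp
        moreover have "?P (tensor_scale c x + y) (s2 c (h x) + h y)"
          by (intro P_add P_scale x y)
        moreover have "tensor_scale c x + y \<in> ?T" using cx y sub by (simp add: T.subspace_add)
        ultimately show ?case unfolding tensor_space_def by metis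
      qed
      then show ?thesis by blast
    qed
    moreover have "h t = 0" if "t \<notin> ?T"
      using h that unfolding is_tensor_lift_def hom_space_def by auto
    ultimately show "h t = g t"
      using geq by (cases "t \<in> ?T") (auto simp: g_def)
  qed
  ultimately show ?thesis by blast
qed


section \<open>Cocommutative coalgebras\<close>

definition cocomm_coalgebra ::
  "('k::field \<Rightarrow> 'a \<Rightarrow> 'a) \<Rightarrow> 'a::ab_group_add set \<Rightarrow> ('a \<Rightarrow> ('k, 'a) tensor) \<Rightarrow> ('a \<Rightarrow> 'k) \<Rightarrow> bool" where
  "cocomm_coalgebra s C \<Delta> \<epsilon> \<longleftrightarrow>
     module.subspace s C \<and>
     linear_on s tensor_scale C \<Delta> \<and> \<Delta> ` C \<subseteq> tensor_space s [C, C] \<and>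
     linear_on s (*) C \<epsilon> \<and>
     (\<comment> \<open>coassociativity\<close>
      \<forall>c\<in>C.
        tensor_lift s tensor_scale [C, C] (\<lambda>p.
          tensor_lift s tensor_scale [C, C] (\<lambda>q. pure_tensor s [C, C, C] [q ! 0, q ! 1, p ! 1])
            (\<Delta> (p ! 0))) (\<Delta> c) =
        tensor_lift s tensor_scale [C, C] (\<lambda>p.
          tensor_lift s tensor_scale [C, C] (\<lambda>q. pure_tensor s [C, C, C] [p ! 0, q ! 0, q ! 1])
            (\<Delta> (p ! 1))) (\<Delta> c)) \<and>
     (\<comment> \<open>counit\<close>
      \<forall>c\<in>C.
        tensor_lift s s [C, C] (\<lambda>p. s (\<epsilon> (p ! 0)) (p ! 1)) (\<Delta> c) = c \<and>
        tensor_lift s s [C, C] (\<lambda>p. s (\<epsilon> (p ! 1)) (p ! 0)) (\<Delta> c) = c) \<and>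
     (\<comment> \<open>cocommutativity\<close>
      \<forall>c\<in>C.
        tensor_lift s tensor_scale [C, C] (\<lambda>p. pure_tensor s [C, C] [p ! 1, p ! 0]) (\<Delta> c) = \<Delta> c)"

definition coalgebra_hom ::
  "('k::field \<Rightarrow> 'a \<Rightarrow> 'a) \<Rightarrow> 'a::ab_group_add set \<Rightarrow> ('a \<Rightarrow> ('k, 'a) tensor) \<Rightarrow> ('a \<Rightarrow> 'k) \<Rightarrow>
   ('k \<Rightarrow> 'b \<Rightarrow> 'b) \<Rightarrow> 'b::ab_group_add set \<Rightarrow> ('b \<Rightarrow> ('k, 'b) tensor) \<Rightarrow> ('b \<Rightarrow> 'k) \<Rightarrow>
   ('a \<Rightarrow> 'b) \<Rightarrow> bool" where
  "coalgebra_hom s D \<Delta>D \<epsilon>D s' C \<Delta>C \<epsilon>C \<Psi> \<longleftrightarrow>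
     \<Psi> \<in> hom_space s s' D C \<and>
     (\<forall>x\<in>D.
        \<Delta>C (\<Psi> x) =
          tensor_lift s tensor_scale [D, D]
            (\<lambda>p. pure_tensor s' [C, C] [\<Psi> (p ! 0), \<Psi> (p ! 1)]) (\<Delta>D x) \<and>
        \<epsilon>C (\<Psi> x) = \<epsilon>D x)"

text \<open>
  \<open>(C, \<Delta>, \<epsilon>)\<close> with \<open>d : C \<rightarrow> V\<close> is a cofree cocommutative coalgebra over \<open>V\<close>.  The test
  coalgebras \<open>D\<close> range over all coalgebra structures on subspaces of the ambient space of
  \<open>C\<close>.  This loses nothing as soon as that space is infinite-dimensional (which is forced
  when \<open>V \<noteq> 0\<close> over an infinite field, since distinct points of \<open>V\<close> lift to distinct,
  hence linearly independent, group-like elements of \<open>C\<close>): every coalgebra is the union of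
  its finite-dimensional subcoalgebras, and each of those has a copy among the \<open>D\<close>.
\<close>

definition cofree_coalgebra ::
  "('k::field \<Rightarrow> 'a \<Rightarrow> 'a) \<Rightarrow> 'a::ab_group_add set \<Rightarrow> ('a \<Rightarrow> ('k, 'a) tensor) \<Rightarrow> ('a \<Rightarrow> 'k) \<Rightarrow>
    'a set \<Rightarrow> ('a \<Rightarrow> 'a) \<Rightarrow> bool" where
  "cofree_coalgebra s C \<Delta> \<epsilon> V d \<longleftrightarrow>
     cocomm_coalgebra s C \<Delta> \<epsilon> \<and>
     linear_on s s C d \<and> d ` C \<subseteq> V \<and>
     (\<forall>D \<Delta>D \<epsilon>D \<phi>.
        cocomm_coalgebra s D \<Delta>D \<epsilon>D \<and> linear_on s s D \<phi> \<and> \<phi> ` D \<subseteq> V \<longrightarrow>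
        (\<exists>!\<Psi>. coalgebra_hom s D \<Delta>D \<epsilon>D s C \<Delta> \<epsilon> \<Psi> \<and> (\<forall>x\<in>D. d (\<Psi> x) = \<phi> x)))"


section \<open>Formulas and proofs\<close>

datatype 'p form =
    Atom 'p
  | Tensor "'p form" "'p form"
  | With "'p form" "'p form"
  | Lolli "'p form" "'p form"
  | Bang "'p form"

primrec subformulas :: "'p form \<Rightarrow> 'p form set" where
  "subformulas (Atom p) = {Atom p}"
| "subformulas (Tensor A B) = insert (Tensor A B) (subformulas A \<union> subformulas B)"
| "subformulas (With A B) = insert (With A B) (subformulas A \<union> subformulas B)"
| "subformulas (Lolli A B) = insert (Lolli A B) (subformulas A \<union> subformulas B)"
| "subformulas (Bang A) = insert (Bang A) (subformulas A)"

text \<open>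
  Proof trees of the sequent calculus.  Contexts are lists; the arguments of a constructor
  are the formulas and contexts needed to read off the conclusion, see \<open>proves\<close>.
\<close>

datatype 'p proof_tree =
    Ax "'p form"
  | Exch "'p form list" "'p form" "'p form" "'p form list" "'p proof_tree"
  | Cut "'p form list" "'p form" "'p form list" "'p form list" "'p proof_tree" "'p proof_tree"
  | TensorL "'p form list" "'p form" "'p form" "'p form list" "'p proof_tree"
  | TensorR "'p form list" "'p form list" "'p form" "'p form" "'p proof_tree" "'p proof_tree"
  | WithL1 "'p form list" "'p form" "'p form" "'p form list" "'p proof_tree"
  | WithL2 "'p form list" "'p form" "'p form" "'p form list" "'p proof_tree"
  | WithR "'p form list" "'p form" "'p form" "'p proof_tree" "'p proof_tree"
  | LolliL "'p form list" "'p form list" "'p form" "'p form" "'p form list" "'p proof_tree" "'p proof_tree"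
  | LolliR "'p form list" "'p form" "'p form" "'p proof_tree"
  | Prom "'p form list" "'p form" "'p proof_tree"
  | Der "'p form list" "'p form" "'p form list" "'p proof_tree"
  | Ctr "'p form list" "'p form" "'p form list" "'p proof_tree"
  | Wk "'p form list" "'p form" "'p form list" "'p proof_tree"

inductive proves :: "'p proof_tree \<Rightarrow> 'p form list \<Rightarrow> 'p form \<Rightarrow> bool" where
  "proves (Ax A) [A] A"
| "proves \<pi> (\<Gamma> @ A # B # \<Delta>) C \<Longrightarrow> proves (Exch \<Gamma> A B \<Delta> \<pi>) (\<Gamma> @ B # A # \<Delta>) C"
| "proves \<pi> \<Gamma> A \<Longrightarrow> proves \<rho> (\<Delta> @ A # \<Theta>) C \<Longrightarrow> proves (Cut \<Gamma> A \<Delta> \<Theta> \<pi> \<rho>) (\<Delta> @ \<Gamma> @ \<Theta>) C"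
| "proves \<pi> (\<Gamma> @ A # B # \<Delta>) C \<Longrightarrow> proves (TensorL \<Gamma> A B \<Delta> \<pi>) (\<Gamma> @ Tensor A B # \<Delta>) C"
| "proves \<pi> \<Gamma> A \<Longrightarrow> proves \<rho> \<Delta> B \<Longrightarrow> proves (TensorR \<Gamma> \<Delta> A B \<pi> \<rho>) (\<Gamma> @ \<Delta>) (Tensor A B)"
| "proves \<pi> (\<Gamma> @ A # \<Delta>) C \<Longrightarrow> proves (WithL1 \<Gamma> A B \<Delta> \<pi>) (\<Gamma> @ With A B # \<Delta>) C"
| "proves \<pi> (\<Gamma> @ B # \<Delta>) C \<Longrightarrow> proves (WithL2 \<Gamma> A B \<Delta> \<pi>) (\<Gamma> @ With A B # \<Delta>) C"
| "proves \<pi> \<Gamma> A \<Longrightarrow> proves \<rho> \<Gamma> B \<Longrightarrow> proves (WithR \<Gamma> A B \<pi> \<rho>) \<Gamma> (With A B)"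
| "proves \<pi> \<Gamma> A \<Longrightarrow> proves \<rho> (\<Delta> @ B # \<Theta>) C \<Longrightarrow>
     proves (LolliL \<Gamma> \<Delta> A B \<Theta> \<pi> \<rho>) (\<Delta> @ Lolli A B # \<Gamma> @ \<Theta>) C"
| "proves \<pi> (\<Gamma> @ [A]) B \<Longrightarrow> proves (LolliR \<Gamma> A B \<pi>) \<Gamma> (Lolli A B)"
| "proves \<pi> (map Bang \<Gamma>) A \<Longrightarrow> proves (Prom \<Gamma> A \<pi>) (map Bang \<Gamma>) (Bang A)"
| "proves \<pi> (\<Gamma> @ A # \<Delta>) C \<Longrightarrow> proves (Der \<Gamma> A \<Delta> \<pi>) (\<Gamma> @ Bang A # \<Delta>) C"
| "proves \<pi> (\<Gamma> @ Bang A # Bang A # \<Delta>) C \<Longrightarrow> proves (Ctr \<Gamma> A \<Delta> \<pi>) (\<Gamma> @ Bang A # \<Delta>) C"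
| "proves \<pi> (\<Gamma> @ \<Delta>) C \<Longrightarrow> proves (Wk \<Gamma> A \<Delta> \<pi>) (\<Gamma> @ Bang A # \<Delta>) C"


section \<open>Binary integers\<close>

definition bint :: "'p form \<Rightarrow> 'p form" where
  "bint A = (let E = Lolli A A in Lolli (Bang E) (Lolli (Bang E) E))"

text \<open>Repeated exchange: from \<open>\<Theta>, X, \<Gamma>, \<Delta>\<close> to \<open>\<Theta>, \<Gamma>, X, \<Delta>\<close>.\<close>

primrec exch_past ::
  "'p form \<Rightarrow> 'p form list \<Rightarrow> 'p form list \<Rightarrow> 'p form list \<Rightarrow> 'p proof_tree \<Rightarrow> 'p proof_tree" where
  "exch_past X [] \<Theta> \<Delta> \<pi> = \<pi>"
| "exch_past X (Y # \<Gamma>) \<Theta> \<Delta> \<pi> = exch_past X \<Gamma> (\<Theta> @ [Y]) \<Delta> (Exch \<Theta> X Y (\<Gamma> @ \<Delta>) \<pi>)"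

text \<open>
  From \<open>\<Gamma>, !X, \<dots>, !X, \<Delta>\<close> with \<open>n\<close> copies of \<open>!X\<close> to \<open>\<Gamma>, !X, \<Delta>\<close>: weakening if there
  are none, otherwise \<open>n - 1\<close> contractions.
\<close>

fun merge_bangs :: "'p form list \<Rightarrow> 'p form \<Rightarrow> nat \<Rightarrow> 'p form list \<Rightarrow> 'p proof_tree \<Rightarrow> 'p proof_tree" where
  "merge_bangs \<Gamma> X 0 \<Delta> \<pi> = Wk \<Gamma> X \<Delta> \<pi>"
| "merge_bangs \<Gamma> X (Suc 0) \<Delta> \<pi> = \<pi>"
| "merge_bangs \<Gamma> X (Suc (Suc n)) \<Delta> \<pi> =
     merge_bangs \<Gamma> X (Suc n) \<Delta> (Ctr \<Gamma> X (replicate n (Bang X) @ \<Delta>) \<pi>)"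

text \<open>
  A binary sequence \<open>s\<^sub>1 \<dots> s\<^sub>l\<close> is a list of booleans (\<open>False\<close> for 0, \<open>True\<close> for 1).
  \<open>bint_chain\<close> recurses over the reversed sequence \<open>s\<^sub>l \<dots> s\<^sub>1\<close>; its proof has one hypothesis
  \<open>!E\<close> per occurrence, first those for the 0s, then those for the 1s, and then \<open>A\<close>.
  It is the linear part \<open>u\<^sub>s\<^sub>l (\<dots> (u\<^sub>s\<^sub>1 a))\<close> of the term of the binary integer, with a separate
  variable for each occurrence.
\<close>

primrec bint_chain :: "'p form \<Rightarrow> bool list \<Rightarrow> 'p proof_tree" where
  "bint_chain A [] = Ax A"
| "bint_chain A (b # r) =
     (let E = Lolli A A;
          zeros = replicate (count_list r False) (Bang E);
          ones = replicate (count_list r True) (Bang E);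
          \<Gamma> = zeros @ ones @ [A];
          \<pi> = Der [] E \<Gamma> (LolliL \<Gamma> [] A A [] (bint_chain A r) (Ax A))
      in if b then exch_past (Bang E) zeros [] (ones @ [A]) \<pi> else \<pi>)"

text \<open>The proof \<open>\<lambda>!u\<^sub>0. \<lambda>!u\<^sub>1. \<lambda>a. u\<^sub>s\<^sub>l (\<dots> (u\<^sub>s\<^sub>1 a))\<close>.\<close>

definition binary_integer :: "'p form \<Rightarrow> bool list \<Rightarrow> 'p proof_tree" where
  "binary_integer A S =
     (let E = Lolli A A;
          n0 = count_list S False;
          n1 = count_list S True;
          \<pi>0 = merge_bangs [] E n0 (replicate n1 (Bang E) @ [A]) (bint_chain A (rev S));
          \<pi>1 = merge_bangs [Bang E] E n1 [A] \<pi>0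
      in LolliR [] (Bang E) (Lolli (Bang E) E)
           (LolliR [Bang E] (Bang E) E
             (LolliR [Bang E, Bang E] A A \<pi>1)))"

lemma proves_exch_past:
  "proves \<pi> (\<Theta> @ X # \<Gamma> @ \<Delta>) C \<Longrightarrow> proves (exch_past X \<Gamma> \<Theta> \<Delta> \<pi>) (\<Theta> @ \<Gamma> @ X # \<Delta>) C"
proof (induction \<Gamma> arbitrary: \<Theta> \<pi>)
  case (Cons Y \<Gamma>)
  have "proves (Exch \<Theta> X Y (\<Gamma> @ \<Delta>) \<pi>) (\<Theta> @ Y # X # \<Gamma> @ \<Delta>) C"
    using Cons.prems by (intro proves.intros) simp
  then show ?case using Cons.IH[of _ "\<Theta> @ [Y]"] by simp
qed simp

lemma proves_merge_bangs:
  "proves \<pi> (\<Gamma> @ replicate n (Bang X) @ \<Delta>) C \<Longrightarrow>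
    proves (merge_bangs \<Gamma> X n \<Delta> \<pi>) (\<Gamma> @ Bang X # \<Delta>) C"
  by (induction \<Gamma> X n \<Delta> \<pi> rule: merge_bangs.induct) (auto intro: proves.intros)

lemma proves_bint_chain:
  "proves (bint_chain A r)
     (replicate (count_list r False) (Bang (Lolli A A)) @
      replicate (count_list r True) (Bang (Lolli A A)) @ [A]) A"
proof (induction r)
  case Nil
  then show ?case by (simp add: proves.intros)
next
  case (Cons b r)
  let ?E = "Lolli A A"
  let ?zs = "replicate (count_list r False) (Bang ?E)"
  let ?os = "replicate (count_list r True) (Bang ?E)"
  let ?\<Gamma> = "?zs @ ?os @ [A]"
  have "proves (LolliL ?\<Gamma> [] A A [] (bint_chain A r) (Ax A)) ([] @ ?E # ?\<Gamma> @ []) A"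
    using Cons.IH by (intro proves.intros(9)) (simp_all add: proves.intros)
  then have *: "proves (Der [] ?E ?\<Gamma> (LolliL ?\<Gamma> [] A A [] (bint_chain A r) (Ax A)))
      ([] @ Bang ?E # ?zs @ (?os @ [A])) A"
    by (intro proves.intros(12)) simp
  show ?case
    using * proves_exch_past[OF *] by (cases b) (simp_all add: Let_def)
qed

lemma proves_binary_integer: "proves (binary_integer A S) [] (bint A)"
proof -
  let ?E = "Lolli A A"
  let ?os = "replicate (count_list S True) (Bang ?E)"
  have "count_list (rev S) b = count_list S b" for b
    by (induction S) auto
  then have "proves (bint_chain A (rev S))
      ([] @ replicate (count_list S False) (Bang ?E) @ ?os @ [A]) A"
    using proves_bint_chain[of A "rev S"] by simp
  from proves_merge_bangs[OF this]
  have "proves (merge_bangs [] ?E (count_list S False) (?os @ [A]) (bint_chain A (rev S)))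
      ([Bang ?E] @ ?os @ [A]) A"
    by simp
  from proves_merge_bangs[OF this]
  have "proves (merge_bangs [Bang ?E] ?E (count_list S True) [A]
      (merge_bangs [] ?E (count_list S False) (?os @ [A]) (bint_chain A (rev S))))
      ([Bang ?E, Bang ?E] @ [A]) A"
    by simp
  from proves.intros(10)[OF this]
  have "proves (LolliR [Bang ?E, Bang ?E] A A
      (merge_bangs [Bang ?E] ?E (count_list S True) [A]
        (merge_bangs [] ?E (count_list S False) (?os @ [A]) (bint_chain A (rev S)))))
      ([Bang ?E] @ [Bang ?E]) ?E"
    by simp
  from proves.intros(10)[OF this]
  have "proves (LolliR [Bang ?E] (Bang ?E) ?E (LolliR [Bang ?E, Bang ?E] A A
      (merge_bangs [Bang ?E] ?E (count_list S True) [A]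
        (merge_bangs [] ?E (count_list S False) (?os @ [A]) (bint_chain A (rev S))))))
      ([] @ [Bang ?E]) (Lolli (Bang ?E) ?E)"
    by simp
  from proves.intros(10)[OF this] show ?thesis
    unfolding binary_integer_def bint_def Let_def .
qed


section \<open>Sweedler semantics\<close>

text \<open>
  A semantics interprets formulas as subspaces of one ambient vector space \<open>'u\<close> with
  scalar multiplication \<open>smult\<close>.  Since the elements of the space of, say, \<open>A \<multimap> B\<close>
  cannot literally be functions on \<open>'u\<close>, the spaces of compound formulas are identified
  with the concrete constructions by linear isomorphisms: \<open>tensor_of A B\<close> from
  \<open>A \<otimes> B\<close> to the tensor product, \<open>pair_of A B\<close> from \<open>A & B\<close> to the direct sum and
  \<open>fun_of A B\<close> from \<open>A \<multimap> B\<close> to the space of linear maps.  The functions \<open>comult A\<close>,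
  \<open>counit A\<close> and \<open>derel A\<close> are the structure maps of the cofree coalgebra \<open>!A\<close>.
\<close>

record ('p, 'k, 'u) semantics =
  smult :: "'k \<Rightarrow> 'u \<Rightarrow> 'u"
  space :: "'p form \<Rightarrow> 'u set"
  tensor_of :: "'p form \<Rightarrow> 'p form \<Rightarrow> 'u \<Rightarrow> ('k, 'u) tensor"
  pair_of :: "'p form \<Rightarrow> 'p form \<Rightarrow> 'u \<Rightarrow> 'u \<times> 'u"
  fun_of :: "'p form \<Rightarrow> 'p form \<Rightarrow> 'u \<Rightarrow> 'u \<Rightarrow> 'u"
  comult :: "'p form \<Rightarrow> 'u \<Rightarrow> ('k, 'u) tensor"
  counit :: "'p form \<Rightarrow> 'u \<Rightarrow> 'k"
  derel :: "'p form \<Rightarrow> 'u \<Rightarrow> 'u"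

text \<open>
  The conditions are imposed for the formulas of a set \<open>F\<close> only (to be closed under
  subformulas): for each formula \<open>B\<close> there is a type \<open>'u\<close> large enough for the
  subformulas of \<open>B\<close>, whereas in general no type formed from \<open>'k\<close> and the spaces of the atoms by
  the type constructors of HOL would do for all formulas at once.
\<close>

definition sweedler_semantics ::
  "'p form set \<Rightarrow> ('p, 'k::field, 'u::ab_group_add) semantics \<Rightarrow> bool" where
  "sweedler_semantics F M \<longleftrightarrow>
     vector_space (smult M) \<and>
     (\<forall>A\<in>F. module.subspace (smult M) (space M A)) \<and>
     (\<forall>A B. Tensor A B \<in> F \<longrightarrow>
        linear_iso (smult M) tensor_scale (space M (Tensor A B))
          (tensor_space (smult M) [space M A, space M B]) (tensor_of M A B)) \<and>
     (\<forall>A B. With A B \<in> F \<longrightarrow>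
        linear_iso (smult M) (prod_scale (smult M) (smult M)) (space M (With A B))
          (space M A \<times> space M B) (pair_of M A B)) \<and>
     (\<forall>A B. Lolli A B \<in> F \<longrightarrow>
        linear_iso (smult M) (fun_scale (smult M)) (space M (Lolli A B))
          (hom_space (smult M) (smult M) (space M A) (space M B)) (fun_of M A B)) \<and>
     (\<forall>A. Bang A \<in> F \<longrightarrow>
        cofree_coalgebra (smult M) (space M (Bang A)) (comult M A) (counit M A)
          (space M A) (derel M A))"

abbreviation context_space :: "('p, 'k::field, 'u::ab_group_add) semantics \<Rightarrow> 'p form list \<Rightarrow> ('k, 'u) tensor set" where
  "context_space M \<Gamma> \<equiv> tensor_space (smult M) (map (space M) \<Gamma>)"

abbreviation context_pure :: "('p, 'k::field, 'u::ab_group_add) semantics \<Rightarrow> 'p form list \<Rightarrow> 'u list \<Rightarrow> ('k, 'u) tensor" where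
  "context_pure M \<Gamma> \<equiv> pure_tensor (smult M) (map (space M) \<Gamma>)"

abbreviation context_lift ::
  "('p, 'k::field, 'u::ab_group_add) semantics \<Rightarrow> ('k \<Rightarrow> 'b \<Rightarrow> 'b) \<Rightarrow> 'p form list \<Rightarrow>
    ('u list \<Rightarrow> 'b::ab_group_add) \<Rightarrow> ('k, 'u) tensor \<Rightarrow> 'b" where
  "context_lift M s \<Gamma> \<equiv> tensor_lift (smult M) s (map (space M) \<Gamma>)"

text \<open>
  The tensor product coalgebra \<open>!A\<^sub>1 \<otimes> \<dots> \<otimes> !A\<^sub>n\<close>.  In Sweedler notation,
  \<open>split_all\<close> sends \<open>c\<^sub>1, \<dots>, c\<^sub>n\<close> to the sum of \<open>h [c\<^sub>1', \<dots>, c\<^sub>n'] [c\<^sub>1'', \<dots>, c\<^sub>n'']\<close>.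
\<close>

primrec split_all ::
  "('p, 'k::field, 'u::ab_group_add) semantics \<Rightarrow> ('k \<Rightarrow> 'b \<Rightarrow> 'b) \<Rightarrow> 'p form list \<Rightarrow>
    ('u list \<Rightarrow> 'u list \<Rightarrow> 'b::ab_group_add) \<Rightarrow> 'u list \<Rightarrow> 'b" where
  "split_all M s [] h cs = h [] []"
| "split_all M s (A # \<Gamma>) h cs =
     context_lift M s [Bang A, Bang A]
       (\<lambda>p. split_all M s \<Gamma> (\<lambda>xs ys. h (p ! 0 # xs) (p ! 1 # ys)) (tl cs))
       (comult M A (hd cs))"

definition context_comult ::
  "('p, 'k::field, 'u::ab_group_add) semantics \<Rightarrow> 'p form list \<Rightarrow>
    ('k, 'u) tensor \<Rightarrow> ('k, ('k, 'u) tensor) tensor" where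
  "context_comult M \<Gamma> =
     context_lift M tensor_scale (map Bang \<Gamma>)
       (split_all M tensor_scale \<Gamma>
         (\<lambda>xs ys. pure_tensor tensor_scale
            [context_space M (map Bang \<Gamma>), context_space M (map Bang \<Gamma>)]
            [context_pure M (map Bang \<Gamma>) xs, context_pure M (map Bang \<Gamma>) ys]))"

definition context_counit ::
  "('p, 'k::field, 'u::ab_group_add) semantics \<Rightarrow> 'p form list \<Rightarrow> ('k, 'u) tensor \<Rightarrow> 'k" where
  "context_counit M \<Gamma> =
     context_lift M (*) (map Bang \<Gamma>) (\<lambda>cs. \<Prod>i<length \<Gamma>. counit M (\<Gamma> ! i) (cs ! i))"

text \<open>
  The linear map from the tensor product of the context to the space of the conclusion.
  In the clauses below a list \<open>vs\<close> of vectors is cut into pieces following the shape of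
  the context of the conclusion.
\<close>

primrec denotation ::
  "('p, 'k::field, 'u::ab_group_add) semantics \<Rightarrow> 'p proof_tree \<Rightarrow> ('k, 'u) tensor \<Rightarrow> 'u" where
  "denotation M (Ax A) = context_lift M (smult M) [A] (\<lambda>vs. vs ! 0)"
| "denotation M (Exch \<Gamma> A B \<Delta> \<pi>) =
     context_lift M (smult M) (\<Gamma> @ B # A # \<Delta>) (\<lambda>vs.
       let n = length \<Gamma>; \<gamma> = take n vs; b = vs ! n; a = vs ! Suc n; \<delta> = drop (n + 2) vs
       in denotation M \<pi> (context_pure M (\<Gamma> @ A # B # \<Delta>) (\<gamma> @ a # b # \<delta>)))"
| "denotation M (Cut \<Gamma> A \<Delta> \<Theta> \<pi> \<rho>) =
     context_lift M (smult M) (\<Delta> @ \<Gamma> @ \<Theta>) (\<lambda>vs.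
       let m = length \<Delta>; n = length \<Gamma>;
           \<delta> = take m vs; \<gamma> = take n (drop m vs); \<theta> = drop (m + n) vs;
           a = denotation M \<pi> (context_pure M \<Gamma> \<gamma>)
       in denotation M \<rho> (context_pure M (\<Delta> @ A # \<Theta>) (\<delta> @ a # \<theta>)))"
| "denotation M (TensorL \<Gamma> A B \<Delta> \<pi>) =
     context_lift M (smult M) (\<Gamma> @ Tensor A B # \<Delta>) (\<lambda>vs.
       let n = length \<Gamma>; \<gamma> = take n vs; t = vs ! n; \<delta> = drop (Suc n) vs
       in context_lift M (smult M) [A, B]
            (\<lambda>p. denotation M \<pi> (context_pure M (\<Gamma> @ A # B # \<Delta>) (\<gamma> @ p ! 0 # p ! 1 # \<delta>)))
            (tensor_of M A B t))"
| "denotation M (TensorR \<Gamma> \<Delta> A B \<pi> \<rho>) =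
     context_lift M (smult M) (\<Gamma> @ \<Delta>) (\<lambda>vs.
       let n = length \<Gamma>; \<gamma> = take n vs; \<delta> = drop n vs;
           a = denotation M \<pi> (context_pure M \<Gamma> \<gamma>); b = denotation M \<rho> (context_pure M \<Delta> \<delta>)
       in inv_into (space M (Tensor A B)) (tensor_of M A B) (context_pure M [A, B] [a, b]))"
| "denotation M (WithL1 \<Gamma> A B \<Delta> \<pi>) =
     context_lift M (smult M) (\<Gamma> @ With A B # \<Delta>) (\<lambda>vs.
       let n = length \<Gamma>; \<gamma> = take n vs; w = vs ! n; \<delta> = drop (Suc n) vs
       in denotation M \<pi> (context_pure M (\<Gamma> @ A # \<Delta>) (\<gamma> @ fst (pair_of M A B w) # \<delta>)))"
| "denotation M (WithL2 \<Gamma> A B \<Delta> \<pi>) =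
     context_lift M (smult M) (\<Gamma> @ With A B # \<Delta>) (\<lambda>vs.
       let n = length \<Gamma>; \<gamma> = take n vs; w = vs ! n; \<delta> = drop (Suc n) vs
       in denotation M \<pi> (context_pure M (\<Gamma> @ B # \<Delta>) (\<gamma> @ snd (pair_of M A B w) # \<delta>)))"
| "denotation M (WithR \<Gamma> A B \<pi> \<rho>) =
     context_lift M (smult M) \<Gamma> (\<lambda>vs.
       let a = denotation M \<pi> (context_pure M \<Gamma> vs); b = denotation M \<rho> (context_pure M \<Gamma> vs)
       in inv_into (space M (With A B)) (pair_of M A B) (a, b))"
| "denotation M (LolliL \<Gamma> \<Delta> A B \<Theta> \<pi> \<rho>) =
     context_lift M (smult M) (\<Delta> @ Lolli A B # \<Gamma> @ \<Theta>) (\<lambda>vs.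
       let m = length \<Delta>; n = length \<Gamma>;
           \<delta> = take m vs; f = vs ! m; \<gamma> = take n (drop (Suc m) vs); \<theta> = drop (Suc m + n) vs;
           b = fun_of M A B f (denotation M \<pi> (context_pure M \<Gamma> \<gamma>))
       in denotation M \<rho> (context_pure M (\<Delta> @ B # \<Theta>) (\<delta> @ b # \<theta>)))"
| "denotation M (LolliR \<Gamma> A B \<pi>) =
     context_lift M (smult M) \<Gamma> (\<lambda>vs.
       inv_into (space M (Lolli A B)) (fun_of M A B)
         (\<lambda>a. if a \<in> space M A then denotation M \<pi> (context_pure M (\<Gamma> @ [A]) (vs @ [a])) else 0))"
| "denotation M (Prom \<Gamma> A \<pi>) =
     (THE \<Psi>. coalgebra_hom
         tensor_scale (context_space M (map Bang \<Gamma>)) (context_comult M \<Gamma>) (context_counit M \<Gamma>)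
         (smult M) (space M (Bang A)) (comult M A) (counit M A) \<Psi> \<and>
       (\<forall>t\<in>context_space M (map Bang \<Gamma>). derel M A (\<Psi> t) = denotation M \<pi> t))"
| "denotation M (Der \<Gamma> A \<Delta> \<pi>) =
     context_lift M (smult M) (\<Gamma> @ Bang A # \<Delta>) (\<lambda>vs.
       let n = length \<Gamma>; \<gamma> = take n vs; c = vs ! n; \<delta> = drop (Suc n) vs
       in denotation M \<pi> (context_pure M (\<Gamma> @ A # \<Delta>) (\<gamma> @ derel M A c # \<delta>)))"
| "denotation M (Ctr \<Gamma> A \<Delta> \<pi>) =
     context_lift M (smult M) (\<Gamma> @ Bang A # \<Delta>) (\<lambda>vs.
       let n = length \<Gamma>; \<gamma> = take n vs; c = vs ! n; \<delta> = drop (Suc n) vs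
       in context_lift M (smult M) [Bang A, Bang A]
            (\<lambda>p. denotation M \<pi>
               (context_pure M (\<Gamma> @ Bang A # Bang A # \<Delta>) (\<gamma> @ p ! 0 # p ! 1 # \<delta>)))
            (comult M A c))"
| "denotation M (Wk \<Gamma> A \<Delta> \<pi>) =
     context_lift M (smult M) (\<Gamma> @ Bang A # \<Delta>) (\<lambda>vs.
       let n = length \<Gamma>; \<gamma> = take n vs; c = vs ! n; \<delta> = drop (Suc n) vs
       in smult M (counit M A c) (denotation M \<pi> (context_pure M (\<Gamma> @ \<Delta>) (\<gamma> @ \<delta>))))"

text \<open>
  A proof without hypotheses denotes the image of \<open>1\<close>, the pure tensor of the empty list.
\<close>

definition closed_denotation ::
  "('p, 'k::field, 'u::ab_group_add) semantics \<Rightarrow> 'p proof_tree \<Rightarrow> 'u" where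
  "closed_denotation M \<pi> = denotation M \<pi> (context_pure M [] [])"

end

(*
  Evaluating the denotation of the binary integer of S at group-like elements over
  endomorphisms alpha_0, alpha_1 gives the composite of the alphas along S.  Choose independent
  x, y in the space of A and let alpha_b x = x + b y and alpha_b y = 2 y (zero on the rest of a
  basis), the linearisation of the affine maps v -> 2 v + b.  The composite along S sends y to
  2^|S| y and x to x + h y, where h is the number with binary digits S.  In a vanishing
  combination c [S] + d [T] the coefficient of x gives c + d = 0; if c were not 0, the
  coefficients of y would give |S| = |T| and equal digit values, hence S = T.
*)
theory Submission
  imports Defs
begin

section \<open>Multilinear maps\<close>

text \<open>Evaluation at points rests on the cofree property tested on a single coalgebra, the line
  with one group-like generator: over every endomorphism it supplies an element of the exponential
  on which contraction copies and weakening multiplies by 1. The main obstacle is well-definedness: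
  \<open>tensor_lift\<close> is a definite description, pinned down by the universal property for
  multilinear maps, so every rule that occurs in a binary integer is shown to denote a linear map of
  the right type together with the formula for its values on pure tensors. The maps v -> 2 v + b
  append a binary digit; two coordinates are needed to express them by linear endomorphisms. The
  digit value alone does not determine a sequence, because leading zeros are invisible to it; the
  image of y is there to record the length. In characteristic zero both natural numbers can be
  recovered from their images in k.\<close>

lemma linear_onD:
  assumes "linear_on s1 s2 V f"
  shows "x \<in> V \<Longrightarrow> y \<in> V \<Longrightarrow> f (x + y) = f x + f y"
    and "x \<in> V \<Longrightarrow> f (s1 c x) = s2 c (f x)"
  using assms by (auto simp: linear_on_def)

lemma linear_on_zero:
  assumes "vector_space s1" "vector_space s2" "module.subspace s1 V" "linear_on s1 s2 V f"
  shows "f 0 = 0"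
proof -
  interpret V: vector_space s1 by fact
  interpret W: vector_space s2 by fact
  show ?thesis
    using linear_onD(2)[OF assms(4) V.subspace_0[OF assms(3)], of 0] by simp
qed

lemma linear_on_compose:
  assumes "linear_on s1 s2 V f" "linear_on s2 s3 W g" "f ` V \<subseteq> W"
  shows "linear_on s1 s3 V (\<lambda>x. g (f x))"
  using assms by (auto simp: linear_on_def image_subset_iff)

lemma vector_space_field: "vector_space ((*) :: 'k::field \<Rightarrow> 'k \<Rightarrow> 'k)"
  by unfold_locales (auto simp: algebra_simps)

lemma vector_space_tensor_scale:
  "vector_space (tensor_scale :: 'k::field \<Rightarrow> ('k, 'a) tensor \<Rightarrow> ('k, 'a) tensor)"
  by (rule vector_space_fun_scale[OF vector_space_field])

section \<open>Lists of vectors with one entry from each space\<close>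

lemma length_listset: "vs \<in> listset Vs \<Longrightarrow> length vs = length Vs"
  by (induction Vs arbitrary: vs) (auto simp: set_Cons_def)

lemma Cons_in_listset [simp]: "v # vs \<in> listset (V # Vs) \<longleftrightarrow> v \<in> V \<and> vs \<in> listset Vs"
  by (auto simp: set_Cons_def)

text \<open>Unfolding to \<open>set_Cons\<close> would hide the membership statements on which
  \<open>Cons_in_listset\<close> and \<open>listset_ConsE\<close> operate.\<close>

declare listset.simps(2) [simp del]

lemma listset_ConsE:
  assumes "vs \<in> listset (V # Vs)"
  obtains w ws where "vs = w # ws" "w \<in> V" "ws \<in> listset Vs"
  using assms by (auto simp: listset.simps set_Cons_def)

lemma listset_appendI: "as \<in> listset As \<Longrightarrow> bs \<in> listset Bs \<Longrightarrow> as @ bs \<in> listset (As @ Bs)"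
  by (induction As arbitrary: as) (auto elim!: listset_ConsE)

lemma listset_appendE:
  assumes "vs \<in> listset (As @ Bs)"
  obtains as bs where "vs = as @ bs" "as \<in> listset As" "bs \<in> listset Bs"
  using assms
proof (induction As arbitrary: vs thesis)
  case (Cons A As)
  from Cons.prems(2) obtain w ws where w: "vs = w # ws" "w \<in> A" "ws \<in> listset (As @ Bs)"
    by (auto elim: listset_ConsE)
  from Cons.IH[OF _ w(3)] obtain as bs where "ws = as @ bs" "as \<in> listset As" "bs \<in> listset Bs"
    by blast
  then show ?case using Cons.prems(1)[of "w # as" bs] w by simp
qed auto

lemma ball_listset_Cons: "(\<forall>vs\<in>listset (V # Vs). P vs) \<longleftrightarrow> (\<forall>v\<in>V. \<forall>vs\<in>listset Vs. P (v # vs))"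
  by (auto elim: listset_ConsE)

lemma ball_listset_append:
  "(\<forall>vs\<in>listset (As @ Bs). P vs) \<longleftrightarrow> (\<forall>as\<in>listset As. \<forall>bs\<in>listset Bs. P (as @ bs))"
  by (auto elim: listset_appendE intro: listset_appendI)

lemma listset_update:
  "vs \<in> listset Vs \<Longrightarrow> i < length Vs \<Longrightarrow> x \<in> Vs ! i \<Longrightarrow> vs[i := x] \<in> listset Vs"
proof (induction Vs arbitrary: vs i)
  case (Cons V Vs)
  then show ?case by (cases i) (auto elim!: listset_ConsE)
qed auto

lemma replicate_in_listset: "g \<in> X \<Longrightarrow> replicate n g \<in> listset (replicate n X)"
  by (induction n) auto

section \<open>Multilinearity in blocks of arguments\<close>

lemma multilinear_on_Nil [simp]: "multilinear_on s1 s2 [] f"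
  by (simp add: multilinear_on_def)

text \<open>Currying the first argument turns the definition by positions into a recursion on the
  list of spaces, so that the simplifier can settle multilinearity for concrete lists.\<close>

lemma multilinear_on_Cons:
  "multilinear_on s1 s2 (V # Vs) f \<longleftrightarrow>
    (\<forall>vs\<in>listset Vs. linear_on s1 s2 V (\<lambda>x. f (x # vs))) \<and>
    (\<forall>v\<in>V. multilinear_on s1 s2 Vs (\<lambda>vs. f (v # vs)))"
  (is "?L \<longleftrightarrow> ?R1 \<and> ?R2")
proof (intro iffI conjI)
  assume L: ?L
  show ?R1
  proof
    fix vs assume vs: "vs \<in> listset Vs"
    \<comment> \<open>The definition speaks of complete lists, so some \<open>v\<close> in
      \<open>V\<close> must be supplied to instantiate it; for empty \<open>V\<close> the claim is
      vacuous.\<close>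
    have "linear_on s1 s2 V (\<lambda>x. f (x # vs))" if "v \<in> V" for v
      using L[unfolded multilinear_on_def, rule_format, of "v # vs" 0] vs that by simp
    then show "linear_on s1 s2 V (\<lambda>x. f (x # vs))"
      by (cases "V = {}") (auto simp: linear_on_def)
  qed
  show ?R2
    unfolding multilinear_on_def
  proof (intro ballI allI impI)
    fix v vs i assume "v \<in> V" "vs \<in> listset Vs" "i < length Vs"
    then show "linear_on s1 s2 (Vs ! i) (\<lambda>x. f (v # vs[i := x]))"
      using L[unfolded multilinear_on_def, rule_format, of "v # vs" "Suc i"] by simp
  qed
next
  assume R: "?R1 \<and> ?R2"
  show ?L
    unfolding multilinear_on_def
  proof (intro ballI allI impI)
    fix ws i assume "ws \<in> listset (V # Vs)" and i: "i < length (V # Vs)"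
    then obtain v vs where ws: "ws = v # vs" "v \<in> V" "vs \<in> listset Vs"
      by (auto elim: listset_ConsE)
    then show "linear_on s1 s2 ((V # Vs) ! i) (\<lambda>x. f (ws[i := x]))"
      using R i by (cases i) (auto simp: multilinear_on_def)
  qed
qed

text \<open>Contexts of the sequent rules are concatenations, so multilinearity is checked on one
  block while the other is held fixed.\<close>

lemma multilinear_on_append:
  "multilinear_on s1 s2 (As @ Bs) f \<longleftrightarrow>
    (\<forall>bs\<in>listset Bs. multilinear_on s1 s2 As (\<lambda>as. f (as @ bs))) \<and>
    (\<forall>as\<in>listset As. multilinear_on s1 s2 Bs (\<lambda>bs. f (as @ bs)))"
proof (induction As arbitrary: f)
  case (Cons V As)
  show ?case
    unfolding append_Cons multilinear_on_Cons Cons.IH ball_listset_Cons ball_listset_append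
    by blast
qed simp

text \<open>Updating an entry preserves the length, so the definition inspects \<open>f\<close> only
  on lists as long as \<open>Vs\<close>. There the cuts by \<open>take\<close> and
  \<open>drop\<close> can be simplified.\<close>

lemma multilinear_on_cong_length:
  assumes "\<And>vs. length vs = length Vs \<Longrightarrow> f vs = g vs"
  shows "multilinear_on s1 s2 Vs f \<longleftrightarrow> multilinear_on s1 s2 Vs g"
  using assms unfolding multilinear_on_def linear_on_def
  by (auto simp: length_listset)

lemma multilinear_on_linear_compose:
  assumes f: "multilinear_on s1 s2 Vs f" and l: "linear_on s2 s3 W l"
    and W: "f ` listset Vs \<subseteq> W"
  shows "multilinear_on s1 s3 Vs (\<lambda>vs. l (f vs))"
  unfolding multilinear_on_def
proof (intro ballI allI impI)
  fix vs i assume vs: "vs \<in> listset Vs" and i: "i < length Vs"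
  show "linear_on s1 s3 (Vs ! i) (\<lambda>x. l (f (vs[i := x])))"
    using f vs i W by (intro linear_on_compose[OF _ l])
      (auto simp: multilinear_on_def image_subset_iff listset_update)
qed

text \<open>
  The shape of the maps in the clauses of \<^const>\<open>denotation\<close>: one distinguished entry
  between two lists.
\<close>

lemma multilinear_on_splitI:
  assumes "\<And>v bs. v \<in> V \<Longrightarrow> bs \<in> listset Bs \<Longrightarrow> multilinear_on s1 s2 As (\<lambda>as. G as v bs)"
    and "\<And>as bs. as \<in> listset As \<Longrightarrow> bs \<in> listset Bs \<Longrightarrow> linear_on s1 s2 V (\<lambda>v. G as v bs)"
    and "\<And>as v. as \<in> listset As \<Longrightarrow> v \<in> V \<Longrightarrow> multilinear_on s1 s2 Bs (\<lambda>bs. G as v bs)"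
    and n: "n = length As"
  shows "multilinear_on s1 s2 (As @ V # Bs) (\<lambda>vs. G (take n vs) (vs ! n) (drop (Suc n) vs))"
  unfolding multilinear_on_append multilinear_on_Cons
proof (intro conjI ballI)
  fix vbs assume "vbs \<in> listset (V # Bs)"
  then obtain v bs where vbs: "vbs = v # bs" "v \<in> V" "bs \<in> listset Bs"
    by (rule listset_ConsE)
  show "multilinear_on s1 s2 As
      (\<lambda>as. G (take n (as @ vbs)) ((as @ vbs) ! n) (drop (Suc n) (as @ vbs)))"
    by (subst multilinear_on_cong_length[where g = "\<lambda>as. G as v bs"])
      (use assms(1)[OF vbs(2,3)] n vbs(1) in \<open>auto simp: nth_append\<close>)
next
  fix as assume as: "as \<in> listset As"
  have [simp]: "length as = n" using length_listset[OF as] n by simp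
  show "linear_on s1 s2 V (\<lambda>x. G (take n (as @ x # bs)) ((as @ x # bs) ! n)
      (drop (Suc n) (as @ x # bs)))" if "bs \<in> listset Bs" for bs
    using assms(2)[OF as that] by (simp add: nth_append)
  show "multilinear_on s1 s2 Bs (\<lambda>bs. G (take n (as @ v # bs)) ((as @ v # bs) ! n)
      (drop (Suc n) (as @ v # bs)))" if "v \<in> V" for v
    using assms(3)[OF as that] by (simp add: nth_append)
qed


section \<open>Linear maps out of tensor products\<close>

lemma subspace_tensor_space:
  fixes s :: "'k::field \<Rightarrow> 'a::ab_group_add \<Rightarrow> 'a"
  shows "module.subspace tensor_scale (tensor_space s Vs)"
proof -
  interpret T: vector_space "tensor_scale :: 'k \<Rightarrow> ('k, 'a) tensor \<Rightarrow> _"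
    by (rule vector_space_tensor_scale)
  show ?thesis by (simp add: tensor_space_def)
qed

lemma pure_tensor_in_tensor_space:
  fixes s :: "'k::field \<Rightarrow> 'a::ab_group_add \<Rightarrow> 'a"
  shows "vs \<in> listset Vs \<Longrightarrow> pure_tensor s Vs vs \<in> tensor_space s Vs"
proof -
  interpret T: vector_space "tensor_scale :: 'k \<Rightarrow> ('k, 'a) tensor \<Rightarrow> _"
    by (rule vector_space_tensor_scale)
  show "vs \<in> listset Vs \<Longrightarrow> pure_tensor s Vs vs \<in> tensor_space s Vs"
    by (simp add: tensor_space_def T.span_base)
qed

text \<open>At a multilinear form \<open>m\<close> this is the multilinearity of \<open>m\<close>
  itself; at any other \<open>m\<close> the default value 0 in \<open>pure_tensor\<close> makes all
  terms vanish.\<close>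

lemma multilinear_on_pure_tensor: "multilinear_on s tensor_scale Vs (pure_tensor s Vs)"
  unfolding multilinear_on_def linear_on_def pure_tensor_def
  by (auto simp: fun_scale_def plus_fun_def fun_eq_iff multilinear_on_def linear_on_def)

lemma multilinear_on_hom_pure_tensor:
  assumes "h \<in> hom_space tensor_scale s2 (tensor_space s1 Vs) W"
  shows "multilinear_on s1 s2 Vs (\<lambda>vs. h (pure_tensor s1 Vs vs))"
  by (rule multilinear_on_linear_compose[OF multilinear_on_pure_tensor])
    (use assms in \<open>auto simp: hom_space_def pure_tensor_in_tensor_space\<close>)

text \<open>Span induction that keeps membership of the partial sum \<open>t\<close>, because the
  maps to which it is applied are linear on the tensor space and not on the whole function
  type.\<close>

lemma tensor_space_induct [consumes 1, case_names zero step]: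
  fixes s :: "'k::field \<Rightarrow> 'a::ab_group_add \<Rightarrow> 'a"
  assumes "t \<in> tensor_space s Vs" and "P 0"
    and "\<And>c vs t. vs \<in> listset Vs \<Longrightarrow> t \<in> tensor_space s Vs \<Longrightarrow> P t \<Longrightarrow>
      P (tensor_scale c (pure_tensor s Vs vs) + t)"
  shows "P t"
proof -
  interpret T: vector_space "tensor_scale :: 'k \<Rightarrow> ('k, 'a) tensor \<Rightarrow> _"
    by (rule vector_space_tensor_scale)
  have "t \<in> tensor_space s Vs \<and> P t"
    using assms(1) unfolding tensor_space_def
  proof (induction rule: T.span_induct_alt)
    case base
    then show ?case using assms(2) T.span_zero by blast
  next
    case (step c x y)
    then show ?case
      using assms(3) unfolding tensor_space_def
      by (blast intro: T.span_add T.span_scale T.span_base)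
  qed
  then show ?thesis by blast
qed

lemma linear_on_tensor_step:
  fixes s1 :: "'k::field \<Rightarrow> 'a::ab_group_add \<Rightarrow> 'a"
  assumes "linear_on tensor_scale s2 (tensor_space s1 Vs) g"
    and "vs \<in> listset Vs" "t \<in> tensor_space s1 Vs"
  shows "g (tensor_scale c (pure_tensor s1 Vs vs) + t) = s2 c (g (pure_tensor s1 Vs vs)) + g t"
proof -
  interpret T: vector_space "tensor_scale :: 'k \<Rightarrow> ('k, 'a) tensor \<Rightarrow> _"
    by (rule vector_space_tensor_scale)
  have p: "pure_tensor s1 Vs vs \<in> tensor_space s1 Vs"
    using assms(2) by (rule pure_tensor_in_tensor_space)
  then have "tensor_scale c (pure_tensor s1 Vs vs) \<in> tensor_space s1 Vs"
    using T.subspace_scale[OF subspace_tensor_space] by blast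
  then show ?thesis
    using linear_onD[OF assms(1)] p assms(3) by metis
qed

lemma linear_on_tensor_space_eqI:
  assumes "vector_space s2"
    and g: "linear_on tensor_scale s2 (tensor_space s1 Vs) g"
    and h: "linear_on tensor_scale s2 (tensor_space s1 Vs) h"
    and eq: "\<And>vs. vs \<in> listset Vs \<Longrightarrow> g (pure_tensor s1 Vs vs) = h (pure_tensor s1 Vs vs)"
    and "t \<in> tensor_space s1 Vs"
  shows "g t = h t"
  using assms(5)
proof (induction rule: tensor_space_induct)
  case zero
  then show ?case
    using linear_on_zero[OF vector_space_tensor_scale assms(1) subspace_tensor_space] g h
    by metis
next
  case (step c vs t)
  then show ?case using linear_on_tensor_step[OF g] linear_on_tensor_step[OF h] eq by metis
qed

section \<open>Lifts of multilinear maps: values, codomain, dependence on parameters\<close>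

lemma is_tensor_lift_tensor_lift:
  assumes "vector_space s2" "multilinear_on s1 s2 Vs f"
  shows "is_tensor_lift s1 s2 Vs f (tensor_lift s1 s2 Vs f)"
  unfolding tensor_lift_def using theI'[OF tensor_universal[OF assms]] .

lemma tensor_lift_pure_tensor:
  assumes "vector_space s2" "multilinear_on s1 s2 Vs f" "vs \<in> listset Vs"
  shows "tensor_lift s1 s2 Vs f (pure_tensor s1 Vs vs) = f vs"
  using is_tensor_lift_tensor_lift[OF assms(1,2)] assms(3) by (simp add: is_tensor_lift_def)

lemma tensor_lift_in_hom_space:
  assumes s2: "vector_space s2" and f: "multilinear_on s1 s2 Vs f"
    and W: "module.subspace s2 W" "\<And>vs. vs \<in> listset Vs \<Longrightarrow> f vs \<in> W"
  shows "tensor_lift s1 s2 Vs f \<in> hom_space tensor_scale s2 (tensor_space s1 Vs) W"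
proof -
  interpret W: vector_space s2 by fact
  let ?g = "tensor_lift s1 s2 Vs f"
  have g: "?g \<in> hom_space tensor_scale s2 (tensor_space s1 Vs) UNIV"
    using is_tensor_lift_tensor_lift[OF s2 f] by (simp add: is_tensor_lift_def)
  then have l: "linear_on tensor_scale s2 (tensor_space s1 Vs) ?g" by (simp add: hom_space_def)
  have "?g t \<in> W" if "t \<in> tensor_space s1 Vs" for t
    using that
  proof (induction rule: tensor_space_induct)
    case zero
    have "?g 0 = 0"
      by (rule linear_on_zero[OF vector_space_tensor_scale s2 subspace_tensor_space l])
    then show ?case using W.subspace_0[OF W(1)] by metis
  next
    case (step c vs t)
    have "?g (tensor_scale c (pure_tensor s1 Vs vs) + t) = s2 c (f vs) + ?g t"
      unfolding linear_on_tensor_step[OF l step(1,2)]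
        tensor_lift_pure_tensor[OF s2 f step(1)] ..
    also have "\<dots> \<in> W"
      using step W by (simp add: W.subspace_add W.subspace_scale)
    finally show ?case .
  qed
  with g show ?thesis by (auto simp: hom_space_def)
qed

lemma linear_on_tensor_lift:
  assumes "vector_space s2" "multilinear_on s1 s2 Vs f"
  shows "linear_on tensor_scale s2 (tensor_space s1 Vs) (tensor_lift s1 s2 Vs f)"
  using is_tensor_lift_tensor_lift[OF assms] by (simp add: is_tensor_lift_def hom_space_def)

text \<open>The property that characterises the lift mentions \<open>f\<close> only on
  \<open>listset Vs\<close>, so both definite descriptions have the same predicate.\<close>

lemma tensor_lift_cong:
  assumes "\<And>vs. vs \<in> listset Vs \<Longrightarrow> f vs = g vs"
  shows "tensor_lift s1 s2 Vs f = tensor_lift s1 s2 Vs g"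
  using assms by (simp add: tensor_lift_def is_tensor_lift_def)

text \<open>Both sides of each linearity equation in \<open>x\<close> are linear in
  \<open>t\<close>, and on pure tensors they reduce to linearity of \<open>f\<close> in
  \<open>x\<close>. Contraction needs this: there the map being lifted depends on the remaining
  entries of the context.\<close>

lemma linear_on_tensor_lift_parameter:
  assumes s2: "vector_space s2" and X: "vector_space s3" "module.subspace s3 X"
    and f: "\<And>x. x \<in> X \<Longrightarrow> multilinear_on s1 s2 Vs (f x)"
    and l: "\<And>vs. vs \<in> listset Vs \<Longrightarrow> linear_on s3 s2 X (\<lambda>x. f x vs)"
    and t: "t \<in> tensor_space s1 Vs"
  shows "linear_on s3 s2 X (\<lambda>x. tensor_lift s1 s2 Vs (f x) t)"
proof -
  interpret W: vector_space s2 by fact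
  interpret X: vector_space s3 by fact
  note lift = linear_on_tensor_lift[OF s2 f]
  note pure = tensor_lift_pure_tensor[OF s2 f]
  show ?thesis
    unfolding linear_on_def
  proof (intro conjI ballI allI)
    fix x y assume x: "x \<in> X" and y: "y \<in> X"
    then have xy: "x + y \<in> X" using X.subspace_add[OF X(2)] by blast
    show "tensor_lift s1 s2 Vs (f (x + y)) t =
        tensor_lift s1 s2 Vs (f x) t + tensor_lift s1 s2 Vs (f y) t"
    proof (rule linear_on_tensor_space_eqI[OF s2 lift[OF xy] _ _ t])
      show "linear_on tensor_scale s2 (tensor_space s1 Vs)
          (\<lambda>t. tensor_lift s1 s2 Vs (f x) t + tensor_lift s1 s2 Vs (f y) t)"
        using lift[OF x] lift[OF y]
        by (simp add: linear_on_def W.scale_right_distrib algebra_simps)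
    qed (simp add: pure x y xy linear_onD(1)[OF l])
  next
    fix c x assume x: "x \<in> X"
    then have cx: "s3 c x \<in> X" using X.subspace_scale[OF X(2)] by blast
    show "tensor_lift s1 s2 Vs (f (s3 c x)) t = s2 c (tensor_lift s1 s2 Vs (f x) t)"
    proof (rule linear_on_tensor_space_eqI[OF s2 lift[OF cx] _ _ t])
      show "linear_on tensor_scale s2 (tensor_space s1 Vs)
          (\<lambda>t. s2 c (tensor_lift s1 s2 Vs (f x) t))"
        using lift[OF x] by (simp add: linear_on_def W.scale_right_distrib mult.commute)
    qed (simp add: pure x cx linear_onD(2)[OF l])
  qed
qed

lemma multilinear_on_tensor_lift_parameter:
  assumes s2: "vector_space s2" and Ws: "vector_space s3" "\<forall>W\<in>set Ws. module.subspace s3 W"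
    and f: "\<And>ws. ws \<in> listset Ws \<Longrightarrow> multilinear_on s1 s2 Vs (f ws)"
    and l: "\<And>vs. vs \<in> listset Vs \<Longrightarrow> multilinear_on s3 s2 Ws (\<lambda>ws. f ws vs)"
    and t: "t \<in> tensor_space s1 Vs"
  shows "multilinear_on s3 s2 Ws (\<lambda>ws. tensor_lift s1 s2 Vs (f ws) t)"
  unfolding multilinear_on_def
proof (intro ballI allI impI)
  fix ws i assume ws: "ws \<in> listset Ws" and i: "i < length Ws"
  show "linear_on s3 s2 (Ws ! i) (\<lambda>x. tensor_lift s1 s2 Vs (f (ws[i := x])) t)"
  proof (intro linear_on_tensor_lift_parameter[OF s2 Ws(1) _ _ _ t])
    show "module.subspace s3 (Ws ! i)" using Ws(2) i by simp
    show "multilinear_on s1 s2 Vs (f (ws[i := x]))" if "x \<in> Ws ! i" for x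
      using f[OF listset_update[OF ws i that]] .
    show "linear_on s3 s2 (Ws ! i) (\<lambda>x. f (ws[i := x]) vs)" if "vs \<in> listset Vs" for vs
      using l[OF that] ws i by (simp add: multilinear_on_def)
  qed
qed

text \<open>The common engine of the rules. \<open>F\<close> is the function in a clause of
  \<open>denotation\<close>, which cuts its list at fixed positions; \<open>G\<close> is the same
  function with the three pieces as separate arguments. Checking \<open>G\<close> piece by piece
  yields both the type of the lift and its value on pure tensors.\<close>

lemma tensor_lift_split:
  assumes "vector_space s2" "module.subspace s2 W"
    and "\<And>v bs. v \<in> V \<Longrightarrow> bs \<in> listset Bs \<Longrightarrow> multilinear_on s1 s2 As (\<lambda>as. G as v bs)"
    and "\<And>as bs. as \<in> listset As \<Longrightarrow> bs \<in> listset Bs \<Longrightarrow> linear_on s1 s2 V (\<lambda>v. G as v bs)"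
    and "\<And>as v. as \<in> listset As \<Longrightarrow> v \<in> V \<Longrightarrow> multilinear_on s1 s2 Bs (\<lambda>bs. G as v bs)"
    and "\<And>as v bs. as \<in> listset As \<Longrightarrow> v \<in> V \<Longrightarrow> bs \<in> listset Bs \<Longrightarrow> G as v bs \<in> W"
    and Vs: "Vs = As @ V # Bs"
    and F: "\<And>as v bs. as \<in> listset As \<Longrightarrow> v \<in> V \<Longrightarrow> bs \<in> listset Bs \<Longrightarrow> F (as @ v # bs) = G as v bs"
  shows "tensor_lift s1 s2 Vs F \<in> hom_space tensor_scale s2 (tensor_space s1 Vs) W"
    and "as \<in> listset As \<Longrightarrow> v \<in> V \<Longrightarrow> bs \<in> listset Bs \<Longrightarrow>
      tensor_lift s1 s2 Vs F (pure_tensor s1 Vs (as @ v # bs)) = G as v bs"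
proof -
  let ?n = "length As"
  let ?G = "\<lambda>vs. G (take ?n vs) (vs ! ?n) (drop (Suc ?n) vs)"
  have G: "?G (as @ v # bs) = G as v bs" if "as \<in> listset As" for as v bs
    using length_listset[OF that] by (simp add: nth_append)
  have ml: "multilinear_on s1 s2 Vs ?G"
    unfolding Vs using assms by (intro multilinear_on_splitI) auto
  \<comment> \<open>\<open>F\<close> and \<open>?G\<close> may differ outside
    \<open>listset Vs\<close>; their lifts do not.\<close>
  have eq: "tensor_lift s1 s2 Vs F = tensor_lift s1 s2 Vs ?G"
    unfolding Vs
    by (rule tensor_lift_cong) (elim listset_appendE listset_ConsE, simp only: F G)
  show "tensor_lift s1 s2 Vs F \<in> hom_space tensor_scale s2 (tensor_space s1 Vs) W"
    unfolding eq
  proof (rule tensor_lift_in_hom_space[OF assms(1) ml assms(2)])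
    show "?G vs \<in> W" if "vs \<in> listset Vs" for vs
      using that unfolding Vs by (elim listset_appendE listset_ConsE) (metis G assms(6))
  qed
  show "tensor_lift s1 s2 Vs F (pure_tensor s1 Vs (as @ v # bs)) = G as v bs"
    if "as \<in> listset As" "v \<in> V" "bs \<in> listset Bs"
    unfolding eq
    unfolding tensor_lift_pure_tensor[OF assms(1) ml, unfolded Vs, OF listset_appendI[OF that(1)],
        OF Cons_in_listset[THEN iffD2, OF conjI, OF that(2,3)], folded Vs]
    by (rule G[OF that(1)])
qed

lemma linear_iso_inv_into:
  assumes "vector_space s1" "module.subspace s1 V" "linear_iso s1 s2 V W f"
  shows "linear_on s2 s1 W (inv_into V f)"
proof -
  interpret V: vector_space s1 by fact
  have f: "linear_on s1 s2 V f" and b: "inj_on f V" "f ` V = W"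
    using assms(3) by (auto simp: linear_iso_def bij_betw_def)
  show ?thesis
    unfolding linear_on_def b(2)[symmetric]
  proof (intro conjI ballI allI; elim imageE; hypsubst)
    fix x y assume xy: "x \<in> V" "y \<in> V"
    then have "inv_into V f (f (x + y)) = x + y"
      using b(1) V.subspace_add[OF assms(2)] by simp
    then show "inv_into V f (f x + f y) = inv_into V f (f x) + inv_into V f (f y)"
      using xy b(1) by (simp add: linear_onD(1)[OF f])
  next
    fix c x assume x: "x \<in> V"
    then have "inv_into V f (f (s1 c x)) = s1 c x"
      using b(1) V.subspace_scale[OF assms(2)] by simp
    then show "inv_into V f (s2 c (f x)) = s1 c (inv_into V f (f x))"
      using x b(1) by (simp add: linear_onD(2)[OF f])
  qed
qed


section \<open>Group-like elements\<close>

text \<open>The ground field as a coalgebra, with 1 group-like, transported to the line through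
  \<open>x\<close>: the comultiplication sends \<open>x\<close> to x tensor x and the counit
  \<kappa> is the coordinate along \<open>x\<close>. Test coalgebras for cofreeness are subspaces of
  the ambient space, hence the realisation as a span.\<close>

lemma cocomm_coalgebra_line:
  fixes s :: "'k::field \<Rightarrow> 'a::ab_group_add \<Rightarrow> 'a"
  assumes s: "vector_space s" and x: "x \<noteq> 0"
  obtains \<kappa> where "linear_on s (*) (module.span s {x}) \<kappa>" "\<kappa> x = 1"
    "\<And>v. v \<in> module.span s {x} \<Longrightarrow> s (\<kappa> v) x = v"
    "cocomm_coalgebra s (module.span s {x})
      (\<lambda>v. tensor_scale (\<kappa> v) (pure_tensor s [module.span s {x}, module.span s {x}] [x, x])) \<kappa>"
proof -
  interpret vector_space s by fact
  interpret T: vector_space "tensor_scale :: 'k \<Rightarrow> ('k, 'a) tensor \<Rightarrow> _"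
    by (rule vector_space_tensor_scale)
  have ind: "independent {x}" using x by simp
  define D where "D = span {x}"
  define \<kappa> where "\<kappa> = (\<lambda>v. representation {x} v x)"
  have lin: "linear_on s (*) D \<kappa>"
    unfolding linear_on_def \<kappa>_def D_def
    by (auto simp: representation_add[OF ind] representation_scale[OF ind])
  have one: "\<kappa> x = 1" by (simp add: \<kappa>_def representation_basis[OF ind])
  have xD: "x \<in> D" by (simp add: D_def span_base)
  have coord: "s (\<kappa> v) x = v" if v: "v \<in> D" for v
  proof -
    obtain c where c: "v = s c x"
      using v by (auto simp: D_def span_singleton)
    then have "\<kappa> v = c" using linear_onD(2)[OF lin xD] one by simp
    with c show ?thesis by simp
  qed
  define \<Delta> where "\<Delta> = (\<lambda>v. tensor_scale (\<kappa> v) (pure_tensor s [D, D] [x, x]))"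
  have D: "subspace D" by (simp add: D_def)
  have scD: "s c v \<in> D" if "v \<in> D" for c v using subspace_scale[OF D that] .
  have ts: "tensor_scale c (pure_tensor s [D, D] [x, x]) \<in> tensor_space s [D, D]" for c
    by (intro T.subspace_scale[OF subspace_tensor_space] pure_tensor_in_tensor_space)
      (simp add: xD)
  \<comment> \<open>Every comultiplied vector is a multiple of the single pure tensor of
    \<open>[x, x]\<close>, so a lift is evaluated at one list only. This drives all the coalgebra
    axioms below.\<close>
  have lift: "tensor_lift s s2 [D, D] f (\<Delta> v) = s2 (\<kappa> v) (f [x, x])"
    if s2: "vector_space s2" and f: "multilinear_on s s2 [D, D] f"
    for s2 :: "'k \<Rightarrow> 'b::ab_group_add \<Rightarrow> 'b" and f v
  proof -
    have "pure_tensor s [D, D] [x, x] \<in> tensor_space s [D, D]"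
      by (rule pure_tensor_in_tensor_space) (simp add: xD)
    from linear_onD(2)[OF linear_on_tensor_lift[OF s2 f] this] show ?thesis
      by (simp add: \<Delta>_def tensor_lift_pure_tensor[OF s2 f] xD)
  qed
  have pure3: "pure_tensor s [D, D, D] [s a x, s b x, s c x] =
      tensor_scale (a * b * c) (pure_tensor s [D, D, D] [x, x, x])" for a b c
    using multilinear_on_pure_tensor[of s "[D, D, D]"] xD scD
    by (simp add: multilinear_on_Cons ball_listset_Cons linear_on_def mult.assoc)
  note ml3 = multilinear_on_pure_tensor[of s "[D, D, D]", unfolded multilinear_on_Cons ball_listset_Cons]
  note ml2 = multilinear_on_pure_tensor[of s "[D, D]", unfolded multilinear_on_Cons ball_listset_Cons]
  have "cocomm_coalgebra s D \<Delta> \<kappa>"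
    unfolding cocomm_coalgebra_def
  proof (intro conjI ballI)
    show "linear_on s tensor_scale D \<Delta>"
      unfolding linear_on_def \<Delta>_def
      by (simp add: linear_onD[OF lin] T.scale_left_distrib)
    show "\<Delta> ` D \<subseteq> tensor_space s [D, D]" using ts by (auto simp: \<Delta>_def)
    fix c assume c: "c \<in> D"
    let ?p = "pure_tensor s [D, D, D] [x, x, x]"
    \<comment> \<open>Common form of the two sides of coassociativity: on u tensor v, comultiplying
      either factor gives \<kappa> u times \<kappa> v times the cube of \<open>x\<close>.\<close>
    let ?m = "\<lambda>p. tensor_scale (\<kappa> (p ! 0) * \<kappa> (p ! 1)) ?p"
    have "tensor_lift s tensor_scale [D, D] (\<lambda>p.
          tensor_lift s tensor_scale [D, D] (\<lambda>q. pure_tensor s [D, D, D] [q ! 0, q ! 1, p ! 1])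
            (\<Delta> (p ! 0))) (\<Delta> c) = tensor_lift s tensor_scale [D, D] ?m (\<Delta> c)"
    proof (intro fun_cong[OF tensor_lift_cong])
      fix vs assume "vs \<in> listset [D, D]"
      then obtain u v where vs: "vs = [u, v]" "u \<in> D" "v \<in> D"
        by (auto elim!: listset_ConsE)
      have "tensor_lift s tensor_scale [D, D] (\<lambda>q. pure_tensor s [D, D, D] [q ! 0, q ! 1, v]) (\<Delta> u)
          = tensor_scale (\<kappa> u) (pure_tensor s [D, D, D] [x, x, v])"
        by (subst lift[OF vector_space_tensor_scale])
          (use ml3 vs xD in \<open>simp_all add: multilinear_on_Cons ball_listset_Cons\<close>)
      moreover have "tensor_scale (\<kappa> u) (pure_tensor s [D, D, D] [x, x, v]) = ?m vs"
        using pure3[of 1 1 "\<kappa> v"] coord[OF vs(3)] by (simp add: vs)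
      ultimately show "tensor_lift s tensor_scale [D, D]
          (\<lambda>q. pure_tensor s [D, D, D] [q ! 0, q ! 1, vs ! 1]) (\<Delta> (vs ! 0)) = ?m vs"
        by (simp add: vs)
    qed
    moreover have "tensor_lift s tensor_scale [D, D] (\<lambda>p.
          tensor_lift s tensor_scale [D, D] (\<lambda>q. pure_tensor s [D, D, D] [p ! 0, q ! 0, q ! 1])
            (\<Delta> (p ! 1))) (\<Delta> c) = tensor_lift s tensor_scale [D, D] ?m (\<Delta> c)"
    proof (intro fun_cong[OF tensor_lift_cong])
      fix vs assume "vs \<in> listset [D, D]"
      then obtain u v where vs: "vs = [u, v]" "u \<in> D" "v \<in> D"
        by (auto elim!: listset_ConsE)
      have "tensor_lift s tensor_scale [D, D] (\<lambda>q. pure_tensor s [D, D, D] [u, q ! 0, q ! 1]) (\<Delta> v)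
          = tensor_scale (\<kappa> v) (pure_tensor s [D, D, D] [u, x, x])"
        by (subst lift[OF vector_space_tensor_scale])
          (use ml3 vs xD in \<open>simp_all add: multilinear_on_Cons ball_listset_Cons\<close>)
      moreover have "tensor_scale (\<kappa> v) (pure_tensor s [D, D, D] [u, x, x]) = ?m vs"
        using pure3[of "\<kappa> u" 1 1] coord[OF vs(2)] by (simp add: vs mult.commute)
      ultimately show "tensor_lift s tensor_scale [D, D]
          (\<lambda>q. pure_tensor s [D, D, D] [vs ! 0, q ! 0, q ! 1]) (\<Delta> (vs ! 1)) = ?m vs"
        by (simp add: vs)
    qed
    ultimately show "tensor_lift s tensor_scale [D, D] (\<lambda>p.
          tensor_lift s tensor_scale [D, D] (\<lambda>q. pure_tensor s [D, D, D] [q ! 0, q ! 1, p ! 1])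
            (\<Delta> (p ! 0))) (\<Delta> c) = tensor_lift s tensor_scale [D, D] (\<lambda>p.
          tensor_lift s tensor_scale [D, D] (\<lambda>q. pure_tensor s [D, D, D] [p ! 0, q ! 0, q ! 1])
            (\<Delta> (p ! 1))) (\<Delta> c)"
      by simp
    show "tensor_lift s s [D, D] (\<lambda>p. s (\<kappa> (p ! 0)) (p ! 1)) (\<Delta> c) = c"
      by (subst lift[OF s])
        (simp_all add: multilinear_on_Cons linear_on_def linear_onD[OF lin] one coord[OF c]
          scale_left_distrib scale_right_distrib mult.commute)
    show "tensor_lift s s [D, D] (\<lambda>p. s (\<kappa> (p ! 1)) (p ! 0)) (\<Delta> c) = c"
      by (subst lift[OF s])
        (simp_all add: multilinear_on_Cons linear_on_def linear_onD[OF lin] one coord[OF c]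
          scale_left_distrib scale_right_distrib mult.commute)
    show "tensor_lift s tensor_scale [D, D] (\<lambda>p. pure_tensor s [D, D] [p ! 1, p ! 0]) (\<Delta> c) = \<Delta> c"
      by (subst lift[OF vector_space_tensor_scale])
        (use ml2 xD in \<open>simp_all add: multilinear_on_Cons ball_listset_Cons \<Delta>_def\<close>)
  qed (rule D lin)+
  then have "cocomm_coalgebra s (span {x})
      (\<lambda>v. tensor_scale (\<kappa> v) (pure_tensor s [span {x}, span {x}] [x, x])) \<kappa>"
    unfolding \<Delta>_def D_def .
  from that[OF _ one _ this] lin coord show thesis
    unfolding D_def by blast
qed

text \<open>
  Lift the map that sends the generator of the one-dimensional coalgebra to \<open>P\<close>; the
  image of the generator is the vector written \<open>|\<emptyset>\<rangle>\<^sub>P\<close> in the paper.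
\<close>

lemma grouplike_exists:
  fixes s :: "'k::field \<Rightarrow> 'a::ab_group_add \<Rightarrow> 'a"
  assumes s: "vector_space s" and x: "x \<noteq> (0 :: 'a)"
    and cofree: "cofree_coalgebra s C \<Delta> \<epsilon> V d" and V: "module.subspace s V" and P: "P \<in> V"
  obtains g where "g \<in> C" "\<Delta> g = pure_tensor s [C, C] [g, g]" "\<epsilon> g = 1" "d g = P"
proof -
  interpret vector_space s by fact
  \<comment> \<open>The line is spanned by an auxiliary nonzero \<open>x\<close> rather than by
    \<open>P\<close>, since \<open>P\<close> may be 0.\<close>
  define D where "D = span {x}"
  obtain \<kappa> where \<kappa>: "linear_on s (*) D \<kappa>" "\<kappa> x = 1"
    "cocomm_coalgebra s D (\<lambda>v. tensor_scale (\<kappa> v) (pure_tensor s [D, D] [x, x])) \<kappa>"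
    unfolding D_def by (rule cocomm_coalgebra_line[OF s x])
  have xD: "x \<in> D" by (simp add: D_def span_base)
  define \<Delta>D where "\<Delta>D = (\<lambda>v. tensor_scale (\<kappa> v) (pure_tensor s [D, D] [x, x]))"
  \<comment> \<open>Chosen so that the generator \<open>x\<close>, whose coordinate is 1, goes to
    \<open>P\<close>; its lift then sends \<open>x\<close> to a group-like element over
    \<open>P\<close>.\<close>
  define \<phi> where "\<phi> = (\<lambda>v. s (\<kappa> v) P)"
  have "linear_on s s D \<phi>"
    using linear_onD[OF \<kappa>(1)] by (simp add: linear_on_def \<phi>_def scale_left_distrib)
  moreover have "\<phi> ` D \<subseteq> V"
    using subspace_scale[OF V P] by (auto simp: \<phi>_def)
  ultimately have "\<exists>!\<Psi>. coalgebra_hom s D \<Delta>D \<kappa> s C \<Delta> \<epsilon> \<Psi> \<and> (\<forall>v\<in>D. d (\<Psi> v) = \<phi> v)"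
    using cofree[unfolded cofree_coalgebra_def, THEN conjunct2, THEN conjunct2, THEN conjunct2,
        THEN spec[of _ D], THEN spec[of _ \<Delta>D], THEN spec[of _ \<kappa>], THEN spec[of _ \<phi>]]
      \<kappa>(3)[folded \<Delta>D_def] by blast
  then obtain \<Psi> where hom: "coalgebra_hom s D \<Delta>D \<kappa> s C \<Delta> \<epsilon> \<Psi>"
    and d: "\<And>v. v \<in> D \<Longrightarrow> d (\<Psi> v) = \<phi> v"
    by blast
  have \<Psi>: "linear_on s s D \<Psi>" "\<And>v. v \<in> D \<Longrightarrow> \<Psi> v \<in> C"
    using hom by (auto simp: coalgebra_hom_def hom_space_def)
  have ml: "multilinear_on s tensor_scale [D, D] (\<lambda>p. pure_tensor s [C, C] [\<Psi> (p ! 0), \<Psi> (p ! 1)])"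
    using multilinear_on_pure_tensor[of s "[C, C]"] \<Psi>
    by (simp add: multilinear_on_Cons ball_listset_Cons linear_on_def)
  have "tensor_scale 1 t = t" for t :: "('k, 'a) tensor" by (simp add: fun_scale_def)
  moreover have "\<Delta> (\<Psi> x) = tensor_lift s tensor_scale [D, D]
      (\<lambda>p. pure_tensor s [C, C] [\<Psi> (p ! 0), \<Psi> (p ! 1)])
      (tensor_scale (\<kappa> x) (pure_tensor s [D, D] [x, x]))"
    using hom xD unfolding coalgebra_hom_def \<Delta>D_def by blast
  ultimately have "\<Delta> (\<Psi> x) = pure_tensor s [C, C] [\<Psi> x, \<Psi> x]"
    using tensor_lift_pure_tensor[OF vector_space_tensor_scale ml, of "[x, x]"] xD \<kappa>(2) by simp
  moreover have "\<epsilon> (\<Psi> x) = 1"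
    using hom xD \<kappa>(2) by (simp add: coalgebra_hom_def)
  ultimately show thesis
    using that[of "\<Psi> x"] \<Psi>(2)[OF xD] d[OF xD] \<kappa>(2) by (simp add: \<phi>_def)
qed

section \<open>Soundness of the rules used by binary integers\<close>

locale sweedler =
  fixes F :: "'p form set" and M :: "('p, 'k::field, 'u::ab_group_add) semantics"
  assumes sem: "sweedler_semantics F M"
begin

sublocale V: vector_space "smult M"
  using sem by (simp add: sweedler_semantics_def)

lemmas vs = V.vector_space_axioms

lemma subspace_space: "A \<in> F \<Longrightarrow> V.subspace (space M A)"
  using sem by (simp add: sweedler_semantics_def)

lemma iso_Lolli:
  "Lolli A B \<in> F \<Longrightarrow> linear_iso (smult M) (fun_scale (smult M)) (space M (Lolli A B))
    (hom_space (smult M) (smult M) (space M A) (space M B)) (fun_of M A B)"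
  using sem by (simp add: sweedler_semantics_def)

lemma cofree_Bang:
  "Bang A \<in> F \<Longrightarrow> cofree_coalgebra (smult M) (space M (Bang A)) (comult M A) (counit M A)
    (space M A) (derel M A)"
  using sem by (simp add: sweedler_semantics_def)

abbreviation vectors :: "'p form list \<Rightarrow> 'u list set" where
  "vectors \<Gamma> \<equiv> listset (map (space M) \<Gamma>)"

text \<open>Well-typedness has to accompany every evaluation formula: the clause for the next rule
  lifts a function built from the values of this denotation, and \<open>sound\<close> is what makes
  those values multilinear.\<close>

abbreviation sound :: "'p proof_tree \<Rightarrow> 'p form list \<Rightarrow> 'p form \<Rightarrow> bool" where
  "sound \<pi> \<Gamma> C \<equiv> denotation M \<pi> \<in> hom_space tensor_scale (smult M) (context_space M \<Gamma>) (space M C)"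

abbreviation den :: "'p proof_tree \<Rightarrow> 'p form list \<Rightarrow> 'u list \<Rightarrow> 'u" where
  "den \<pi> \<Gamma> vs \<equiv> denotation M \<pi> (context_pure M \<Gamma> vs)"

lemma den_in_space: "sound \<pi> \<Gamma> C \<Longrightarrow> vs \<in> vectors \<Gamma> \<Longrightarrow> den \<pi> \<Gamma> vs \<in> space M C"
  by (auto simp: hom_space_def pure_tensor_in_tensor_space)

lemma multilinear_den:
  "sound \<pi> \<Gamma> C \<Longrightarrow> multilinear_on (smult M) (smult M) (map (space M) \<Gamma>) (den \<pi> \<Gamma>)"
  by (rule multilinear_on_hom_pure_tensor)

section \<open>Axiom and exchange\<close>

lemma sound_Ax:
  assumes "A \<in> F"
  shows "sound (Ax A) [A] A" and "a \<in> space M A \<Longrightarrow> den (Ax A) [A] [a] = a"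
proof -
  have ml: "multilinear_on (smult M) (smult M) [space M A] (\<lambda>vs. vs ! 0)"
    by (simp add: multilinear_on_Cons linear_on_def)
  show "sound (Ax A) [A] A"
    unfolding denotation.simps list.map
    by (rule tensor_lift_in_hom_space[OF vs ml subspace_space[OF assms]])
      (auto elim: listset_ConsE)
  show "a \<in> space M A \<Longrightarrow> den (Ax A) [A] [a] = a"
    using tensor_lift_pure_tensor[OF vs ml, of "[a]"] by simp
qed

lemma sound_Exch:
  assumes "C \<in> F" and \<pi>: "sound \<pi> (\<Gamma> @ A # B # \<Delta>) C"
  shows "sound (Exch \<Gamma> A B \<Delta> \<pi>) (\<Gamma> @ B # A # \<Delta>) C"
    and "\<gamma> \<in> vectors \<Gamma> \<Longrightarrow> b \<in> space M B \<Longrightarrow> a \<in> space M A \<Longrightarrow> \<delta> \<in> vectors \<Delta> \<Longrightarrow>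
      den (Exch \<Gamma> A B \<Delta> \<pi>) (\<Gamma> @ B # A # \<Delta>) (\<gamma> @ b # a # \<delta>) =
      den \<pi> (\<Gamma> @ A # B # \<Delta>) (\<gamma> @ a # b # \<delta>)"
proof -
  note ml = multilinear_den[OF \<pi>, simplified multilinear_on_append multilinear_on_Cons
      ball_listset_Cons list.map map_append]
  \<comment> \<open>\<open>tensor_lift_split\<close> singles out one entry, here \<open>b\<close>;
    its neighbour \<open>a\<close> becomes the head of the trailing block
    \<open>\<theta>\<close>.\<close>
  let ?G = "\<lambda>\<gamma> b \<theta>. den \<pi> (\<Gamma> @ A # B # \<Delta>) (\<gamma> @ hd \<theta> # b # tl \<theta>)"
  note split = tensor_lift_split[where As = "map (space M) \<Gamma>" and V = "space M B"
      and Bs = "map (space M) (A # \<Delta>)" and G = ?G, OF vs subspace_space[OF assms(1)]]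
  have G: "?G \<gamma> b \<theta> \<in> space M C"
    if "\<gamma> \<in> vectors \<Gamma>" "b \<in> space M B" "\<theta> \<in> vectors (A # \<Delta>)" for \<gamma> b \<theta>
    using that by (intro den_in_space[OF \<pi>]) (auto elim!: listset_ConsE intro!: listset_appendI)
  show "sound (Exch \<Gamma> A B \<Delta> \<pi>) (\<Gamma> @ B # A # \<Delta>) C"
    unfolding denotation.simps Let_def
    by (rule split(1)) (use ml G in \<open>auto simp: multilinear_on_Cons length_listset nth_append
        hd_drop_conv_nth elim!: listset_ConsE\<close>)
  show "den (Exch \<Gamma> A B \<Delta> \<pi>) (\<Gamma> @ B # A # \<Delta>) (\<gamma> @ b # a # \<delta>) =
      den \<pi> (\<Gamma> @ A # B # \<Delta>) (\<gamma> @ a # b # \<delta>)"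
    if "\<gamma> \<in> vectors \<Gamma>" "b \<in> space M B" "a \<in> space M A" "\<delta> \<in> vectors \<Delta>"
    unfolding denotation.simps Let_def
    by (rule trans[OF split(2)]) (use that ml G in \<open>auto simp: multilinear_on_Cons length_listset
        nth_append hd_drop_conv_nth elim!: listset_ConsE\<close>)
qed


section \<open>Dereliction, weakening and contraction\<close>

lemma derel_linear:
  assumes "Bang A \<in> F"
  shows "linear_on (smult M) (smult M) (space M (Bang A)) (derel M A)"
    and "c \<in> space M (Bang A) \<Longrightarrow> derel M A c \<in> space M A"
  using cofree_Bang[OF assms] by (auto simp: cofree_coalgebra_def)

lemma counit_linear:
  "Bang A \<in> F \<Longrightarrow> linear_on (smult M) (*) (space M (Bang A)) (counit M A)"
  using cofree_Bang by (simp add: cofree_coalgebra_def cocomm_coalgebra_def)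

lemma comult_linear:
  assumes "Bang A \<in> F"
  shows "linear_on (smult M) tensor_scale (space M (Bang A)) (comult M A)"
    and "c \<in> space M (Bang A) \<Longrightarrow> comult M A c \<in> context_space M [Bang A, Bang A]"
  using cofree_Bang[OF assms] by (auto simp: cofree_coalgebra_def cocomm_coalgebra_def)

lemma sound_Der:
  assumes "C \<in> F" "Bang A \<in> F" and \<pi>: "sound \<pi> (\<Gamma> @ A # \<Delta>) C"
  shows "sound (Der \<Gamma> A \<Delta> \<pi>) (\<Gamma> @ Bang A # \<Delta>) C"
    and "\<gamma> \<in> vectors \<Gamma> \<Longrightarrow> c \<in> space M (Bang A) \<Longrightarrow> \<delta> \<in> vectors \<Delta> \<Longrightarrow>
      den (Der \<Gamma> A \<Delta> \<pi>) (\<Gamma> @ Bang A # \<Delta>) (\<gamma> @ c # \<delta>) =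
      den \<pi> (\<Gamma> @ A # \<Delta>) (\<gamma> @ derel M A c # \<delta>)"
proof -
  note ml = multilinear_den[OF \<pi>, simplified multilinear_on_append multilinear_on_Cons
      ball_listset_Cons list.map map_append]
  note d = derel_linear[OF assms(2)]
  let ?G = "\<lambda>\<gamma> c \<delta>. den \<pi> (\<Gamma> @ A # \<Delta>) (\<gamma> @ derel M A c # \<delta>)"
  note split = tensor_lift_split[where As = "map (space M) \<Gamma>" and V = "space M (Bang A)"
      and Bs = "map (space M) \<Delta>" and G = ?G, OF vs subspace_space[OF assms(1)]]
  have G: "?G \<gamma> c \<delta> \<in> space M C"
    if "\<gamma> \<in> vectors \<Gamma>" "c \<in> space M (Bang A)" "\<delta> \<in> vectors \<Delta>" for \<gamma> c \<delta>
    using that d by (intro den_in_space[OF \<pi>]) (auto intro!: listset_appendI)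
  have lin: "linear_on (smult M) (smult M) (space M (Bang A)) (\<lambda>c. ?G \<gamma> c \<delta>)"
    if "\<gamma> \<in> vectors \<Gamma>" "\<delta> \<in> vectors \<Delta>" for \<gamma> \<delta>
    using ml that d(2) by (intro linear_on_compose[OF d(1), where W = "space M A"]) auto
  show "sound (Der \<Gamma> A \<Delta> \<pi>) (\<Gamma> @ Bang A # \<Delta>) C"
    unfolding denotation.simps Let_def
    by (rule split(1)) (use ml G lin d(2) in \<open>auto simp: length_listset nth_append\<close>)
  show "den (Der \<Gamma> A \<Delta> \<pi>) (\<Gamma> @ Bang A # \<Delta>) (\<gamma> @ c # \<delta>) = ?G \<gamma> c \<delta>"
    if "\<gamma> \<in> vectors \<Gamma>" "c \<in> space M (Bang A)" "\<delta> \<in> vectors \<Delta>"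
    unfolding denotation.simps Let_def
    by (rule trans[OF split(2)])
      (use that ml G lin d(2) in \<open>auto simp: length_listset nth_append\<close>)
qed

lemma sound_Wk:
  assumes "C \<in> F" "Bang A \<in> F" and \<pi>: "sound \<pi> (\<Gamma> @ \<Delta>) C"
  shows "sound (Wk \<Gamma> A \<Delta> \<pi>) (\<Gamma> @ Bang A # \<Delta>) C"
    and "\<gamma> \<in> vectors \<Gamma> \<Longrightarrow> c \<in> space M (Bang A) \<Longrightarrow> \<delta> \<in> vectors \<Delta> \<Longrightarrow>
      den (Wk \<Gamma> A \<Delta> \<pi>) (\<Gamma> @ Bang A # \<Delta>) (\<gamma> @ c # \<delta>) =
      smult M (counit M A c) (den \<pi> (\<Gamma> @ \<Delta>) (\<gamma> @ \<delta>))"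
proof -
  note ml = multilinear_den[OF \<pi>, simplified multilinear_on_append map_append]
  note e = counit_linear[OF assms(2)]
  let ?G = "\<lambda>\<gamma> c \<delta>. smult M (counit M A c) (den \<pi> (\<Gamma> @ \<Delta>) (\<gamma> @ \<delta>))"
  note split = tensor_lift_split[where As = "map (space M) \<Gamma>" and V = "space M (Bang A)"
      and Bs = "map (space M) \<Delta>" and G = ?G, OF vs subspace_space[OF assms(1)]]
  have G: "?G \<gamma> c \<delta> \<in> space M C"
    if "\<gamma> \<in> vectors \<Gamma>" "c \<in> space M (Bang A)" "\<delta> \<in> vectors \<Delta>" for \<gamma> c \<delta>
    using that by (intro V.subspace_scale[OF subspace_space[OF assms(1)]] den_in_space[OF \<pi>])
      (auto intro!: listset_appendI)
  have lin: "linear_on (smult M) (smult M) (space M (Bang A)) (\<lambda>c. ?G \<gamma> c \<delta>)" for \<gamma> \<delta>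
    using linear_onD[OF e] by (simp add: linear_on_def V.scale_left_distrib)
  have sc: "linear_on (smult M) (smult M) UNIV (smult M k)" for k
    by (simp add: linear_on_def V.scale_right_distrib mult.commute)
  have ml': "multilinear_on (smult M) (smult M) (map (space M) \<Gamma>) (\<lambda>\<gamma>. ?G \<gamma> c \<delta>)"
    if "\<delta> \<in> vectors \<Delta>" for c \<delta>
    using ml that by (intro multilinear_on_linear_compose[OF _ sc]) auto
  have ml'': "multilinear_on (smult M) (smult M) (map (space M) \<Delta>) (\<lambda>\<delta>. ?G \<gamma> c \<delta>)"
    if "\<gamma> \<in> vectors \<Gamma>" for c \<gamma>
    using ml that by (intro multilinear_on_linear_compose[OF _ sc]) auto
  show "sound (Wk \<Gamma> A \<Delta> \<pi>) (\<Gamma> @ Bang A # \<Delta>) C"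
    unfolding denotation.simps Let_def
    by (rule split(1)) (use ml' ml'' G lin in \<open>auto simp: length_listset nth_append\<close>)
  show "den (Wk \<Gamma> A \<Delta> \<pi>) (\<Gamma> @ Bang A # \<Delta>) (\<gamma> @ c # \<delta>) = ?G \<gamma> c \<delta>"
    if "\<gamma> \<in> vectors \<Gamma>" "c \<in> space M (Bang A)" "\<delta> \<in> vectors \<Delta>"
    unfolding denotation.simps Let_def
    by (rule trans[OF split(2)])
      (use that ml' ml'' G lin in \<open>auto simp: length_listset nth_append\<close>)
qed

text \<open>The value at a general element is a lift over its comultiplication; at an element whose
  comultiplication is g tensor g the lift collapses to using \<open>g\<close> twice. The spaces in
  \<open>\<Gamma>\<close> and \<open>\<Delta>\<close> are asked to be subspaces, through
  \<open>sub\<close>, because the lift must be multilinear in these entries as parameters.\<close>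

lemma sound_Ctr:
  assumes "C \<in> F" "Bang A \<in> F" and sub: "set \<Gamma> \<subseteq> F" "set \<Delta> \<subseteq> F"
    and \<pi>: "sound \<pi> (\<Gamma> @ Bang A # Bang A # \<Delta>) C"
  shows "sound (Ctr \<Gamma> A \<Delta> \<pi>) (\<Gamma> @ Bang A # \<Delta>) C"
    and "\<gamma> \<in> vectors \<Gamma> \<Longrightarrow> g \<in> space M (Bang A) \<Longrightarrow> \<delta> \<in> vectors \<Delta> \<Longrightarrow>
      comult M A g = context_pure M [Bang A, Bang A] [g, g] \<Longrightarrow>
      den (Ctr \<Gamma> A \<Delta> \<pi>) (\<Gamma> @ Bang A # \<Delta>) (\<gamma> @ g # \<delta>) =
      den \<pi> (\<Gamma> @ Bang A # Bang A # \<Delta>) (\<gamma> @ g # g # \<delta>)"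
proof -
  note ml = multilinear_den[OF \<pi>, simplified multilinear_on_append multilinear_on_Cons
      ball_listset_Cons list.map map_append]
  note c = comult_linear[OF assms(2)]
  let ?H = "\<lambda>\<gamma> \<delta> p. den \<pi> (\<Gamma> @ Bang A # Bang A # \<Delta>) (\<gamma> @ p ! 0 # p ! 1 # \<delta>)"
  let ?G = "\<lambda>\<gamma> c \<delta>. context_lift M (smult M) [Bang A, Bang A] (?H \<gamma> \<delta>) (comult M A c)"
  note split = tensor_lift_split[where As = "map (space M) \<Gamma>" and V = "space M (Bang A)"
      and Bs = "map (space M) \<Delta>" and G = ?G, OF vs subspace_space[OF assms(1)]]
  have H: "multilinear_on (smult M) (smult M) (map (space M) [Bang A, Bang A]) (?H \<gamma> \<delta>)"
    if "\<gamma> \<in> vectors \<Gamma>" "\<delta> \<in> vectors \<Delta>" for \<gamma> \<delta>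
    using ml that by (simp add: multilinear_on_Cons ball_listset_Cons)
  have G: "?G \<gamma> c \<delta> \<in> space M C"
    if "\<gamma> \<in> vectors \<Gamma>" "c \<in> space M (Bang A)" "\<delta> \<in> vectors \<Delta>" for \<gamma> c \<delta>
  proof -
    have "context_lift M (smult M) [Bang A, Bang A] (?H \<gamma> \<delta>) \<in>
        hom_space tensor_scale (smult M) (context_space M [Bang A, Bang A]) (space M C)"
      by (rule tensor_lift_in_hom_space[OF vs H[OF that(1,3)] subspace_space[OF assms(1)]],
          rule den_in_space[OF \<pi>])
        (use that in \<open>auto intro!: listset_appendI elim!: listset_ConsE\<close>)
    then show ?thesis using c(2)[OF that(2)] by (auto simp: hom_space_def)
  qed
  have lin: "linear_on (smult M) (smult M) (space M (Bang A)) (\<lambda>c. ?G \<gamma> c \<delta>)"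
    if "\<gamma> \<in> vectors \<Gamma>" "\<delta> \<in> vectors \<Delta>" for \<gamma> \<delta>
    by (rule linear_on_compose[OF c(1) linear_on_tensor_lift[OF vs H[OF that]]])
      (use c(2) in auto)
  have ml': "multilinear_on (smult M) (smult M) (map (space M) \<Gamma>) (\<lambda>\<gamma>. ?G \<gamma> c \<delta>)"
    if "c \<in> space M (Bang A)" "\<delta> \<in> vectors \<Delta>" for c \<delta>
    by (rule multilinear_on_tensor_lift_parameter[OF vs vs _ _ _ c(2)])
      (use that ml H sub subspace_space in \<open>auto elim!: listset_ConsE\<close>)
  have ml'': "multilinear_on (smult M) (smult M) (map (space M) \<Delta>) (\<lambda>\<delta>. ?G \<gamma> c \<delta>)"
    if "c \<in> space M (Bang A)" "\<gamma> \<in> vectors \<Gamma>" for c \<gamma>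
    by (rule multilinear_on_tensor_lift_parameter[OF vs vs _ _ _ c(2)])
      (use that ml H sub subspace_space in \<open>auto elim!: listset_ConsE\<close>)
  show "sound (Ctr \<Gamma> A \<Delta> \<pi>) (\<Gamma> @ Bang A # \<Delta>) C"
    unfolding denotation.simps Let_def
    by (rule split(1)) (use ml' ml'' G lin in \<open>auto simp: length_listset nth_append\<close>)
  show "den (Ctr \<Gamma> A \<Delta> \<pi>) (\<Gamma> @ Bang A # \<Delta>) (\<gamma> @ g # \<delta>) =
      den \<pi> (\<Gamma> @ Bang A # Bang A # \<Delta>) (\<gamma> @ g # g # \<delta>)"
    if \<gamma>: "\<gamma> \<in> vectors \<Gamma>" and g: "g \<in> space M (Bang A)" and \<delta>: "\<delta> \<in> vectors \<Delta>"
      and comult: "comult M A g = context_pure M [Bang A, Bang A] [g, g]"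
  proof -
    have "den (Ctr \<Gamma> A \<Delta> \<pi>) (\<Gamma> @ Bang A # \<Delta>) (\<gamma> @ g # \<delta>) = ?G \<gamma> g \<delta>"
      unfolding denotation.simps Let_def
      by (rule trans[OF split(2)])
        (use \<gamma> g \<delta> ml' ml'' G lin in \<open>auto simp: length_listset nth_append\<close>)
    also have "\<dots> = ?H \<gamma> \<delta> [g, g]"
      unfolding comult by (rule tensor_lift_pure_tensor[OF vs H[OF \<gamma> \<delta>]]) (simp add: g)
    finally show ?thesis by simp
  qed
qed

section \<open>Linear implication\<close>

lemma fun_of_linear:
  assumes "Lolli A B \<in> F"
  shows "linear_on (smult M) (fun_scale (smult M)) (space M (Lolli A B)) (fun_of M A B)"
    and "f \<in> space M (Lolli A B) \<Longrightarrow>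
      fun_of M A B f \<in> hom_space (smult M) (smult M) (space M A) (space M B)"
    and "h \<in> hom_space (smult M) (smult M) (space M A) (space M B) \<Longrightarrow>
      fun_of M A B (inv_into (space M (Lolli A B)) (fun_of M A B) h) = h"
    and "h \<in> hom_space (smult M) (smult M) (space M A) (space M B) \<Longrightarrow>
      inv_into (space M (Lolli A B)) (fun_of M A B) h \<in> space M (Lolli A B)"
  using iso_Lolli[OF assms] unfolding linear_iso_def bij_betw_def
  by (auto simp: f_inv_into_f inv_into_into)

lemma sound_LolliL:
  assumes "Lolli A B \<in> F" "C \<in> F" and \<pi>: "sound \<pi> \<Gamma> A" and \<rho>: "sound \<rho> [B] C"
  shows "sound (LolliL \<Gamma> [] A B [] \<pi> \<rho>) (Lolli A B # \<Gamma>) C"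
    and "f \<in> space M (Lolli A B) \<Longrightarrow> \<gamma> \<in> vectors \<Gamma> \<Longrightarrow>
      den (LolliL \<Gamma> [] A B [] \<pi> \<rho>) (Lolli A B # \<Gamma>) (f # \<gamma>) =
      den \<rho> [B] [fun_of M A B f (den \<pi> \<Gamma> \<gamma>)]"
proof -
  note L = fun_of_linear[OF assms(1)]
  have \<rho>_lin: "linear_on (smult M) (smult M) (space M B) (\<lambda>b. den \<rho> [B] [b])"
    using multilinear_den[OF \<rho>] by (simp add: multilinear_on_Cons)
  \<comment> \<open>\<open>\<epsilon>\<close> stands for the empty block in front of the function
    entry, demanded by the three-piece shape of \<open>tensor_lift_split\<close>.\<close>
  let ?G = "\<lambda>\<epsilon> f \<gamma>. den \<rho> [B] [fun_of M A B f (den \<pi> \<Gamma> \<gamma>)]"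
  note split = tensor_lift_split[where As = "[]" and V = "space M (Lolli A B)"
      and Bs = "map (space M) \<Gamma>" and G = ?G, OF vs subspace_space[OF assms(2)]]
  have f: "linear_on (smult M) (smult M) (space M A) (fun_of M A B f)"
    "a \<in> space M A \<Longrightarrow> fun_of M A B f a \<in> space M B" if "f \<in> space M (Lolli A B)" for f a
    using L(2)[OF that] by (auto simp: hom_space_def)
  have G: "?G \<epsilon> f \<gamma> \<in> space M C"
    if "f \<in> space M (Lolli A B)" "\<gamma> \<in> vectors \<Gamma>" for \<epsilon> f \<gamma>
    using f(2)[OF that(1) den_in_space[OF \<pi> that(2)]] by (intro den_in_space[OF \<rho>]) simp
  have lin: "linear_on (smult M) (smult M) (space M (Lolli A B)) (\<lambda>f. ?G \<epsilon> f \<gamma>)"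
    if "\<gamma> \<in> vectors \<Gamma>" for \<epsilon> \<gamma>
  proof (rule linear_on_compose[OF _ \<rho>_lin])
    show "linear_on (smult M) (smult M) (space M (Lolli A B)) (\<lambda>f. fun_of M A B f (den \<pi> \<Gamma> \<gamma>))"
      using L(1) by (simp add: linear_on_def fun_scale_def plus_fun_def)
    show "(\<lambda>f. fun_of M A B f (den \<pi> \<Gamma> \<gamma>)) ` space M (Lolli A B) \<subseteq> space M B"
      using f(2) den_in_space[OF \<pi> that] by auto
  qed
  have ml: "multilinear_on (smult M) (smult M) (map (space M) \<Gamma>) (\<lambda>\<gamma>. ?G \<epsilon> f \<gamma>)"
    if "f \<in> space M (Lolli A B)" for \<epsilon> f
  proof (rule multilinear_on_linear_compose[OF _ linear_on_compose[OF f(1)[OF that] \<rho>_lin]])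
    show "multilinear_on (smult M) (smult M) (map (space M) \<Gamma>) (den \<pi> \<Gamma>)"
      by (rule multilinear_den[OF \<pi>])
  qed (use f(2)[OF that] den_in_space[OF \<pi>] in auto)
  show "sound (LolliL \<Gamma> [] A B [] \<pi> \<rho>) (Lolli A B # \<Gamma>) C"
    unfolding denotation.simps Let_def
    by (simp, rule split(1)) (use G lin ml in \<open>auto simp: length_listset\<close>)
  show "den (LolliL \<Gamma> [] A B [] \<pi> \<rho>) (Lolli A B # \<Gamma>) (f # \<gamma>) = ?G [] f \<gamma>"
    if "f \<in> space M (Lolli A B)" "\<gamma> \<in> vectors \<Gamma>"
    unfolding denotation.simps Let_def
    by (simp, rule trans[OF split(2)[where as = "[]", simplified]])
      (use that G lin ml in \<open>auto simp: length_listset\<close>)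
qed

lemma sound_LolliR:
  assumes "Lolli A B \<in> F" "A \<in> F" and \<pi>: "sound \<pi> (\<Gamma> @ [A]) B"
  shows "sound (LolliR \<Gamma> A B \<pi>) \<Gamma> (Lolli A B)"
    and "\<gamma> \<in> vectors \<Gamma> \<Longrightarrow> a \<in> space M A \<Longrightarrow>
      fun_of M A B (den (LolliR \<Gamma> A B \<pi>) \<Gamma> \<gamma>) a = den \<pi> (\<Gamma> @ [A]) (\<gamma> @ [a])"
proof -
  note L = fun_of_linear[OF assms(1)]
  note ml = multilinear_den[OF \<pi>, simplified multilinear_on_append multilinear_on_Cons
      ball_listset_Cons list.map map_append]
  let ?inv = "inv_into (space M (Lolli A B)) (fun_of M A B)"
  \<comment> \<open>The value 0 outside the space of \<open>A\<close> is the convention of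
    \<open>hom_space\<close>, so \<open>?H \<gamma>\<close> is in the range of \<open>fun_of\<close>
    and the inverse can be applied to it.\<close>
  let ?H = "\<lambda>\<gamma> a. if a \<in> space M A then den \<pi> (\<Gamma> @ [A]) (\<gamma> @ [a]) else 0"
  have sub: "V.subspace (space M A)" "V.subspace (space M (Lolli A B))"
    using assms(1,2) subspace_space by auto
  have H: "?H \<gamma> \<in> hom_space (smult M) (smult M) (space M A) (space M B)"
    if "\<gamma> \<in> vectors \<Gamma>" for \<gamma>
    using ml that V.subspace_add[OF sub(1)] V.subspace_scale[OF sub(1)]
      den_in_space[OF \<pi>]
    by (auto simp: hom_space_def linear_on_def listset_appendI)
  \<comment> \<open>Function spaces have pointwise operations, so this is checked at each argument
    \<open>a\<close> separately.\<close>
  have "multilinear_on (smult M) (fun_scale (smult M)) (map (space M) \<Gamma>) ?H"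
    using ml by (auto simp: multilinear_on_def linear_on_def fun_scale_def fun_eq_iff)
  then have m: "multilinear_on (smult M) (smult M) (map (space M) \<Gamma>) (\<lambda>\<gamma>. ?inv (?H \<gamma>))"
    by (rule multilinear_on_linear_compose[OF _ linear_iso_inv_into[OF vs sub(2) iso_Lolli[OF assms(1)]]])
      (use H in auto)
  show "sound (LolliR \<Gamma> A B \<pi>) \<Gamma> (Lolli A B)"
    unfolding denotation.simps
    by (rule tensor_lift_in_hom_space[OF vs m sub(2)]) (rule L(4)[OF H])
  show "fun_of M A B (den (LolliR \<Gamma> A B \<pi>) \<Gamma> \<gamma>) a = den \<pi> (\<Gamma> @ [A]) (\<gamma> @ [a])"
    if "\<gamma> \<in> vectors \<Gamma>" "a \<in> space M A"
    unfolding denotation.simps tensor_lift_pure_tensor[OF vs m that(1)] L(3)[OF H[OF that(1)]]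
    using that(2) by simp
qed

section \<open>Iterated rules and the binary integer\<close>

lemma sound_exch_past:
  assumes "C \<in> F" "sound \<pi> (\<Theta> @ X # \<Gamma> @ \<Delta>) C"
  shows "sound (exch_past X \<Gamma> \<Theta> \<Delta> \<pi>) (\<Theta> @ \<Gamma> @ X # \<Delta>) C"
    and "\<theta> \<in> vectors \<Theta> \<Longrightarrow> \<gamma> \<in> vectors \<Gamma> \<Longrightarrow> x \<in> space M X \<Longrightarrow> \<delta> \<in> vectors \<Delta> \<Longrightarrow>
      den (exch_past X \<Gamma> \<Theta> \<Delta> \<pi>) (\<Theta> @ \<Gamma> @ X # \<Delta>) (\<theta> @ \<gamma> @ x # \<delta>) =
      den \<pi> (\<Theta> @ X # \<Gamma> @ \<Delta>) (\<theta> @ x # \<gamma> @ \<delta>)"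
  using assms(2)
proof (induction \<Gamma> arbitrary: \<Theta> \<pi> \<theta> \<gamma>)
  case Nil
  { case 1 then show ?case by simp }
  { case 2 then show ?case by simp }
next
  case (Cons Y \<Gamma>)
  have step: "sound (Exch \<Theta> X Y (\<Gamma> @ \<Delta>) \<pi>) ((\<Theta> @ [Y]) @ X # \<Gamma> @ \<Delta>) C"
    if "sound \<pi> (\<Theta> @ X # (Y # \<Gamma>) @ \<Delta>) C" for \<Theta> \<pi>
    using sound_Exch(1)[OF assms(1), of \<pi> \<Theta> X Y "\<Gamma> @ \<Delta>"] that by simp
  { case 1 then show ?case using Cons.IH(1)[OF step[OF 1]] by simp }
  { case 2
    then obtain y \<gamma>' where \<gamma>: "\<gamma> = y # \<gamma>'" "y \<in> space M Y" "\<gamma>' \<in> vectors \<Gamma>"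
      by (auto elim: listset_ConsE)
    have \<theta>: "\<theta> @ [y] \<in> vectors (\<Theta> @ [Y])"
      using 2(1) \<gamma>(2) by (simp add: listset_appendI)
    have "\<gamma>' @ \<delta> \<in> vectors (\<Gamma> @ \<Delta>)" using \<gamma>(3) 2(4) by (simp add: listset_appendI)
    then show ?case
      using Cons.IH(2)[OF \<theta> \<gamma>(3) 2(3,4) step[OF 2(5)]]
        sound_Exch(2)[OF assms(1), of \<pi> \<Theta> X Y "\<Gamma> @ \<Delta>" \<theta> y x "\<gamma>' @ \<delta>"] 2 \<gamma>
      by simp }
qed

text \<open>The comultiplication condition makes contraction a copy, the counit condition makes
  weakening a deletion without a scalar factor. The endomorphism lying under \<open>g\<close> is
  read off by \<open>derel\<close>.\<close>

definition grouplike :: "'p form \<Rightarrow> 'u \<Rightarrow> bool" where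
  "grouplike A g \<longleftrightarrow> g \<in> space M (Bang A) \<and>
    comult M A g = context_pure M [Bang A, Bang A] [g, g] \<and> counit M A g = 1"

text \<open>At a group-like \<open>g\<close> each contraction duplicates \<open>g\<close> and a
  weakening multiplies by the counit 1. One formula with \<open>n\<close> copies therefore covers
  all cases, including \<open>n = 0\<close>.\<close>

lemma sound_merge_bangs:
  assumes "C \<in> F" "Bang X \<in> F" "set \<Gamma> \<subseteq> F" "set \<Delta> \<subseteq> F"
    and "sound \<pi> (\<Gamma> @ replicate n (Bang X) @ \<Delta>) C"
  shows "sound (merge_bangs \<Gamma> X n \<Delta> \<pi>) (\<Gamma> @ Bang X # \<Delta>) C"
    and "\<gamma> \<in> vectors \<Gamma> \<Longrightarrow> grouplike X g \<Longrightarrow> \<delta> \<in> vectors \<Delta> \<Longrightarrow>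
      den (merge_bangs \<Gamma> X n \<Delta> \<pi>) (\<Gamma> @ Bang X # \<Delta>) (\<gamma> @ g # \<delta>) =
      den \<pi> (\<Gamma> @ replicate n (Bang X) @ \<Delta>) (\<gamma> @ replicate n g @ \<delta>)"
  using assms
proof (induction \<Gamma> X n \<Delta> \<pi> rule: merge_bangs.induct)
  case (1 \<Gamma> X \<Delta> \<pi>)
  { case 1 then show ?case using sound_Wk(1)[of C X \<pi> \<Gamma> \<Delta>] by simp }
  { case 2 then show ?case using sound_Wk(2)[of C X \<pi> \<Gamma> \<Delta> \<gamma> g \<delta>] by (simp add: grouplike_def) }
next
  case (2 \<Gamma> X \<Delta> \<pi>)
  { case 1 then show ?case by simp }
  { case 2 then show ?case by simp }
next
  case (3 \<Gamma> X n \<Delta> \<pi>)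
  have Bangs: "set (replicate n (Bang X) @ \<Delta>) \<subseteq> F" if "Bang X \<in> F" "set \<Delta> \<subseteq> F"
    using that by auto
  have step: "sound (Ctr \<Gamma> X (replicate n (Bang X) @ \<Delta>) \<pi>)
      (\<Gamma> @ replicate (Suc n) (Bang X) @ \<Delta>) C"
    if "C \<in> F" "Bang X \<in> F" "set \<Gamma> \<subseteq> F" "set \<Delta> \<subseteq> F"
      "sound \<pi> (\<Gamma> @ replicate (Suc (Suc n)) (Bang X) @ \<Delta>) C"
    using sound_Ctr(1)[OF that(1-3) Bangs[OF that(2,4)], of \<pi>] that(5) by simp
  { case 1 then show ?case using 3(1)[OF 1(1-4) step[OF 1]] by simp }
  { case 2
    have "replicate n g @ \<delta> \<in> vectors (replicate n (Bang X) @ \<Delta>)"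
      using 2 by (auto simp: grouplike_def map_replicate_const intro!: listset_appendI replicate_in_listset)
    then show ?case
      using 3(2)[OF 2(1-7) step[OF 2(4-8)]]
        sound_Ctr(2)[OF 2(4-6) Bangs[OF 2(5,7)], of \<pi> \<gamma> g "replicate n g @ \<delta>"] 2
      by (simp add: grouplike_def) }
qed

text \<open>The head of \<open>r\<close> is the outermost letter, hence \<open>foldr\<close>. Each
  letter enters as a new hypothesis at the front of the context; this is already the head of the
  block of zeros, whereas for a one it still has to travel past that block.\<close>

lemma sound_bint_chain:
  fixes A :: "'p form"
  defines "E \<equiv> Lolli A A"
  assumes F: "A \<in> F" "E \<in> F" "Bang E \<in> F"
  shows "sound (bint_chain A r)
      (replicate (count_list r False) (Bang E) @ replicate (count_list r True) (Bang E) @ [A]) A"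
    and "(\<And>b. g b \<in> space M (Bang E)) \<Longrightarrow> a \<in> space M A \<Longrightarrow>
      den (bint_chain A r)
        (replicate (count_list r False) (Bang E) @ replicate (count_list r True) (Bang E) @ [A])
        (replicate (count_list r False) (g False) @ replicate (count_list r True) (g True) @ [a]) =
      foldr (\<lambda>b. fun_of M A A (derel M E (g b))) r a"
proof (induction r)
  case Nil
  { case 1 show ?case using sound_Ax(1)[OF F(1)] by simp }
  { case 2 then show ?case using sound_Ax(2)[OF F(1)] by simp }
next
  case (Cons b r)
  let ?zs = "replicate (count_list r False) (Bang E)"
  let ?os = "replicate (count_list r True) (Bang E)"
  let ?\<Gamma> = "?zs @ ?os @ [A]"
  let ?\<pi> = "LolliL ?\<Gamma> [] A A [] (bint_chain A r) (Ax A)"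
  note chain = Cons.IH(1)
  note \<pi> = sound_LolliL(1)[OF F(2)[unfolded E_def] F(1) chain sound_Ax(1)[OF F(1)], folded E_def]
  have Der: "sound (Der [] E ?\<Gamma> ?\<pi>) ([] @ Bang E # ?zs @ ?os @ [A]) A"
    by (rule sound_Der(1)[OF F(1,3)]) (simp add: \<pi>[simplified])
  have chain_eq: "bint_chain A (b # r) = (if b then
      exch_past (Bang E) ?zs [] (?os @ [A]) (Der [] E ?\<Gamma> ?\<pi>) else Der [] E ?\<Gamma> ?\<pi>)"
    by (simp add: Let_def E_def)
  { case 1 show ?case
      unfolding chain_eq using Der sound_exch_past(1)[OF F(1) Der] by (cases b) simp_all }
  { case 2
    let ?gz = "replicate (count_list r False) (g False)"
    let ?go = "replicate (count_list r True) (g True)"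
    have gz: "?gz \<in> vectors ?zs" and go: "?go \<in> vectors ?os"
      using 2(1) by (simp_all add: map_replicate_const replicate_in_listset)
    have goa: "?go @ [a] \<in> vectors (?os @ [A])"
      using go 2(2) by (simp add: listset_appendI)
    have \<gamma>: "?gz @ ?go @ [a] \<in> vectors ?\<Gamma>"
      using gz goa by (simp add: listset_appendI)
    have d: "derel M E (g b) \<in> space M E" by (rule derel_linear(2)[OF F(3) 2(1)])
    have "den (Der [] E ?\<Gamma> ?\<pi>) ([] @ Bang E # ?\<Gamma>) ([] @ g b # ?gz @ ?go @ [a]) =
        den ?\<pi> ([] @ E # ?\<Gamma>) ([] @ derel M E (g b) # ?gz @ ?go @ [a])"
      by (rule sound_Der(2)[OF F(1,3)]) (use \<pi> 2(1) \<gamma> in simp_all)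
    also have "\<dots> = den (Ax A) [A] [fun_of M A A (derel M E (g b))
        (den (bint_chain A r) ?\<Gamma> (?gz @ ?go @ [a]))]"
      using sound_LolliL(2)[OF F(2)[unfolded E_def] F(1) chain sound_Ax(1)[OF F(1)], folded E_def,
          OF d \<gamma>] by simp
    also have "den (bint_chain A r) ?\<Gamma> (?gz @ ?go @ [a]) =
        foldr (\<lambda>b. fun_of M A A (derel M E (g b))) r a"
      by (rule Cons.IH(2)[OF 2])
    also have "den (Ax A) [A] [fun_of M A A (derel M E (g b))
        (foldr (\<lambda>b. fun_of M A A (derel M E (g b))) r a)] =
        foldr (\<lambda>b. fun_of M A A (derel M E (g b))) (b # r) a"
      using fun_of_linear(2)[OF F(2)[unfolded E_def], folded E_def, OF d]
        den_in_space[OF chain \<gamma>] unfolding Cons.IH(2)[OF 2]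
      by (subst sound_Ax(2)[OF F(1)]) (simp_all add: hom_space_def image_subset_iff)
    finally have *: "den (Der [] E ?\<Gamma> ?\<pi>) ([] @ Bang E # ?\<Gamma>) ([] @ g b # ?gz @ ?go @ [a]) =
        foldr (\<lambda>b. fun_of M A A (derel M E (g b))) (b # r) a" .
    \<comment> \<open>For \<open>True\<close> the exchanges carry \<open>g True\<close> past the
      copies in \<open>?gz\<close> to the head of \<open>?go\<close>.\<close>
    show ?case
      unfolding chain_eq
      using * sound_exch_past(2)[OF F(1) Der, of "[]" ?gz "g True" "?go @ [a]"] gz goa 2(1)
      by (cases b) simp_all }
qed

text \<open>The three applications of \<open>fun_of\<close> undo the three uses of
  \<open>LolliR\<close>; merging then hands the same \<open>g b\<close> to every occurrence of the
  letter \<open>b\<close>, and the chain composes the derelictions. Reversal makes the last letter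
  of \<open>S\<close> the outermost map.\<close>

lemma sound_binary_integer:
  fixes A :: "'p form"
  defines "E \<equiv> Lolli A A"
  assumes F: "subformulas (bint A) \<subseteq> F"
  shows "closed_denotation M (binary_integer A S) \<in> space M (bint A)"
    and "(\<And>b. grouplike E (g b)) \<Longrightarrow> a \<in> space M A \<Longrightarrow>
      fun_of M A A (fun_of M (Bang E) E
        (fun_of M (Bang E) (Lolli (Bang E) E) (closed_denotation M (binary_integer A S))
          (g False)) (g True)) a =
      foldr (\<lambda>b. fun_of M A A (derel M E (g b))) (rev S) a"
proof -
  have A: "A \<in> subformulas A" by (cases A) auto
  have F: "A \<in> F" "E \<in> F" "Bang E \<in> F" "Lolli (Bang E) E \<in> F" "Lolli (Bang E) (Lolli (Bang E) E) \<in> F"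
    using F A by (auto simp: bint_def Let_def E_def)
  have count: "count_list (rev S) b = count_list S b" for b
    by (induction S) auto
  let ?os = "replicate (count_list S True) (Bang E)"
  define \<pi>0 where "\<pi>0 = merge_bangs [] E (count_list S False) (?os @ [A]) (bint_chain A (rev S))"
  define \<pi>1 where "\<pi>1 = merge_bangs [Bang E] E (count_list S True) [A] \<pi>0"
  define \<pi>2 where "\<pi>2 = LolliR [Bang E, Bang E] A A \<pi>1"
  define \<pi>3 where "\<pi>3 = LolliR [Bang E] (Bang E) E \<pi>2"
  have eq: "binary_integer A S = LolliR [] (Bang E) (Lolli (Bang E) E) \<pi>3"
    by (simp add: binary_integer_def Let_def E_def \<pi>0_def \<pi>1_def \<pi>2_def \<pi>3_def)
  note chain = sound_bint_chain[OF F(1-3)[unfolded E_def], folded E_def, where r = "rev S", unfolded count]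
  have chain': "sound (bint_chain A (rev S))
      ([] @ replicate (count_list S False) (Bang E) @ ?os @ [A]) A"
    using chain(1) by simp
  have os: "set (?os @ [A]) \<subseteq> F" "set [Bang E] \<subseteq> F" "set [A] \<subseteq> F" "set [] \<subseteq> F" using F by auto
  note s0 = sound_merge_bangs[OF F(1,3) os(4,1) chain', folded \<pi>0_def]
  have s0': "sound \<pi>0 ([Bang E] @ ?os @ [A]) A" using s0(1) by simp
  note s1 = sound_merge_bangs[OF F(1,3) os(2,3) s0', folded \<pi>1_def]
  have s1': "sound \<pi>1 ([Bang E, Bang E] @ [A]) A" using s1(1) by simp
  note s2 = sound_LolliR[OF F(2)[unfolded E_def] F(1) s1', folded \<pi>2_def, folded E_def]
  have s2': "sound \<pi>2 ([Bang E] @ [Bang E]) E" using s2(1) by simp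
  note s3 = sound_LolliR[OF F(4,3) s2', folded \<pi>3_def]
  have s3': "sound \<pi>3 ([] @ [Bang E]) (Lolli (Bang E) E)" using s3(1) by simp
  note s4 = sound_LolliR[OF F(5,3) s3', folded eq]
  show "closed_denotation M (binary_integer A S) \<in> space M (bint A)"
    using den_in_space[OF s4(1), of "[]"]
    by (simp add: closed_denotation_def bint_def Let_def E_def)
  assume g: "\<And>b. grouplike E (g b)" and a: "a \<in> space M A"
  have gs: "g b \<in> space M (Bang E)" for b using g by (simp add: grouplike_def)
  have go: "replicate (count_list S True) (g True) @ [a] \<in> vectors (?os @ [A])"
    using gs a by (auto simp: map_replicate_const intro!: listset_appendI replicate_in_listset)
  have "fun_of M A A (fun_of M (Bang E) E
        (fun_of M (Bang E) (Lolli (Bang E) E) (closed_denotation M (binary_integer A S))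
          (g False)) (g True)) a = den \<pi>1 ([Bang E, Bang E] @ [A]) ([g False, g True] @ [a])"
    using s4(2)[of "[]" "g False"] s3(2)[of "[g False]" "g True"] s2(2)[of "[g False, g True]" a] gs a
    by (simp add: closed_denotation_def)
  also have "\<dots> = den \<pi>0 ([Bang E] @ ?os @ [A])
      ([g False] @ replicate (count_list S True) (g True) @ [a])"
    using s1(2)[OF _ g, of "[g False]" "[a]" True] gs a by simp
  also have "\<dots> = foldr (\<lambda>b. fun_of M A A (derel M E (g b))) (rev S) a"
    using s0(2)[OF _ g go, of "[]" False] chain(2)[OF gs a] by simp
  finally show "fun_of M A A (fun_of M (Bang E) E
        (fun_of M (Bang E) (Lolli (Bang E) E) (closed_denotation M (binary_integer A S))
          (g False)) (g True)) a = foldr (\<lambda>b. fun_of M A A (derel M E (g b))) (rev S) a" .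
qed

end


section \<open>Separating binary sequences by two endomorphisms\<close>

text \<open>The head of the list is the lowest binary digit, so parity recovers it and the rest
  follows by induction. Equal lengths exclude padding by high-order zeros, which the sum does not
  see.\<close>

lemma horner_sum_of_bool_inject:
  assumes "length xs = length ys"
    and "horner_sum of_bool (2 :: nat) xs = horner_sum of_bool 2 ys"
  shows "xs = ys"
  using assms
proof (induction xs ys rule: list_induct2)
  case (Cons x xs y ys)
  have "x = y"
    using arg_cong[OF Cons.prems, of odd] by simp
  with Cons show ?case by simp
qed simp

text \<open>Dimension at least 2, infinite dimension included, is expressed by the size of a basis.
  Inequality of the two denotations is part of the conclusion because a set \<open>{v, v}\<close> is
  a singleton, which is independent for every nonzero v.\<close>

theorem propositionB13:
  fixes M :: "('p, 'k::{alg_closed_field, field_char_0}, 'u::ab_group_add) semantics"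
    and A :: "'p form"
    and S T :: "bool list"
    and basis :: "'u set"
  assumes semantics: "sweedler_semantics (subformulas (bint A)) M"
    and basis: "\<not> module.dependent (smult M) basis" "module.span (smult M) basis = space M A"
    and dim_ge_2: "infinite basis \<or> card basis \<ge> 2"
    and distinct: "S \<noteq> T"
  shows "closed_denotation M (binary_integer A S) \<in> space M (bint A) \<and>
    closed_denotation M (binary_integer A T) \<in> space M (bint A) \<and>
    closed_denotation M (binary_integer A S) \<noteq> closed_denotation M (binary_integer A T) \<and>
    \<not> module.dependent (smult M)
        {closed_denotation M (binary_integer A S), closed_denotation M (binary_integer A T)}"
proof -
  interpret sweedler "subformulas (bint A)" M by unfold_locales (rule semantics)
  let ?E = "Lolli A A"
  let ?s = "smult M"
  let ?D = "\<lambda>S. closed_denotation M (binary_integer A S)"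
  have "A \<in> subformulas A" by (cases A) auto
  then have F: "A \<in> subformulas (bint A)" "?E \<in> subformulas (bint A)" "Bang ?E \<in> subformulas (bint A)"
    "Lolli (Bang ?E) ?E \<in> subformulas (bint A)"
    "Lolli (Bang ?E) (Lolli (Bang ?E) ?E) \<in> subformulas (bint A)"
    by (auto simp: bint_def Let_def)
  \<comment> \<open>A set contained in no singleton has two distinct elements. The infinite case is
    separate since \<open>card\<close> is 0 there.\<close>
  have "\<not> basis \<subseteq> {x}" for x
    using dim_ge_2 card_mono[of "{x}" basis] finite_subset[of basis "{x}"] by auto
  then obtain x y where xy: "x \<in> basis" "y \<in> basis" "x \<noteq> y" by blast
  have xyA: "x \<in> space M A" "y \<in> space M A"
    using xy by (auto simp: basis(2)[symmetric] V.span_base)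
  note subA = subspace_space[OF F(1)]
  define rep where "rep = V.representation basis"
  have rep_add: "rep (u + v) z = rep u z + rep v z" if "u \<in> space M A" "v \<in> space M A" for u v z
    using V.representation_add[OF basis(1)] that by (simp add: rep_def basis(2))
  have rep_scale: "rep (?s c u) z = c * rep u z" if "u \<in> space M A" for c u z
    using V.representation_scale[OF basis(1)] that by (simp add: rep_def basis(2))
  have rep_basis: "rep x x = 1" "rep x y = 0" "rep y x = 0" "rep y y = 1"
    using V.representation_basis[OF basis(1)] xy by (auto simp: rep_def)
  \<comment> \<open>In the coordinates along \<open>x\<close> and \<open>y\<close> this is the
    matrix with rows (1, 0) and (b, 2): the coordinate along \<open>x\<close> plays the part of the
    constant 1 of an affine map.\<close>
  define \<alpha> where "\<alpha> = (\<lambda>b v. if v \<in> space M A then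
    ?s (rep v x) (x + ?s (of_bool b) y) + ?s (2 * rep v y) y else 0)"
  have \<alpha>: "\<alpha> b \<in> hom_space ?s ?s (space M A) (space M A)" for b
  proof -
    have "linear_on ?s ?s (space M A) (\<alpha> b)"
      using V.subspace_add[OF subA] V.subspace_scale[OF subA]
      by (simp add: linear_on_def \<alpha>_def rep_add rep_scale V.scale_left_distrib
          V.scale_right_distrib distrib_left mult.left_commute ac_simps)
    moreover have "\<alpha> b v \<in> space M A" if "v \<in> space M A" for v
      using that xyA by (simp add: \<alpha>_def V.subspace_add[OF subA] V.subspace_scale[OF subA])
    ultimately show ?thesis by (auto simp: hom_space_def \<alpha>_def)
  qed
  have fold_y: "foldr \<alpha> r y = ?s (2 ^ length r) y" for r
    by (induction r) (simp_all add: \<alpha>_def rep_scale rep_basis xyA V.subspace_scale[OF subA])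
  \<comment> \<open>Applying \<open>\<alpha> b\<close> replaces the coefficient h of
    \<open>y\<close> by b + 2 h, the Horner step with the head of \<open>r\<close> as lowest
    digit.\<close>
  have fold_x: "foldr \<alpha> r x = x + ?s (of_nat (horner_sum of_bool 2 r)) y" for r
    by (induction r)
      (simp_all add: \<alpha>_def rep_add rep_scale rep_basis xyA V.subspace_scale[OF subA]
        V.subspace_add[OF subA] V.scale_left_distrib V.scale_right_distrib add.assoc)
  have "\<exists>g. grouplike ?E g \<and> fun_of M A A (derel M ?E g) = \<alpha> b" for b
  proof -
    \<comment> \<open>The basis vector \<open>x\<close> also serves as the nonzero vector spanning
      the test coalgebra. The point to lift is the preimage of \<open>\<alpha> b\<close> under
      \<open>fun_of\<close>.\<close>
    have "x \<noteq> 0" using rep_basis(1) V.representation_zero by (auto simp: rep_def)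
    from grouplike_exists[OF vs this cofree_Bang[OF F(3)] subspace_space[OF F(2)]
        fun_of_linear(4)[OF F(2) \<alpha>]]
    obtain g where "g \<in> space M (Bang ?E)"
      "comult M ?E g = pure_tensor ?s [space M (Bang ?E), space M (Bang ?E)] [g, g]"
      "counit M ?E g = 1" "derel M ?E g = inv_into (space M ?E) (fun_of M A A) (\<alpha> b)" .
    then show ?thesis
      using fun_of_linear(3)[OF F(2) \<alpha>] by (intro exI[of _ g]) (simp add: grouplike_def)
  qed
  then obtain g where g: "\<And>b. grouplike ?E (g b)"
    and g_\<alpha>: "\<And>b. fun_of M A A (derel M ?E (g b)) = \<alpha> b"
    by metis
  \<comment> \<open>With the group-like pair held fixed, evaluation is linear in \<open>t\<close>;
    it carries a relation between denotations to the same relation between composites of the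
    \<open>\<alpha> b\<close>.\<close>
  define ev where "ev = (\<lambda>t. fun_of M A A (fun_of M (Bang ?E) ?E
    (fun_of M (Bang ?E) (Lolli (Bang ?E) ?E) t (g False)) (g True)))"
  have bint: "space M (bint A) = space M (Lolli (Bang ?E) (Lolli (Bang ?E) ?E))"
    by (simp add: bint_def Let_def)
  have D: "?D S \<in> space M (bint A)" for S by (rule sound_binary_integer(1)) simp
  have ev_D: "ev (?D S) a = foldr \<alpha> (rev S) a" if "a \<in> space M A" for S a
    using sound_binary_integer(2)[OF subset_refl g that] by (simp add: ev_def g_\<alpha>)
  have gs: "g b \<in> space M (Bang ?E)" for b using g by (simp add: grouplike_def)
  have ev_lin: "linear_on ?s (fun_scale ?s) (space M (bint A)) ev"
  proof -
    note L = fun_of_linear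
    have 1: "linear_on ?s ?s (space M (bint A))
        (\<lambda>t. fun_of M (Bang ?E) (Lolli (Bang ?E) ?E) t (g False))"
      using L(1)[OF F(5)] by (simp add: linear_on_def bint fun_scale_def)
    have 2: "linear_on ?s ?s (space M (Lolli (Bang ?E) ?E)) (\<lambda>t. fun_of M (Bang ?E) ?E t (g True))"
      using L(1)[OF F(4)] by (simp add: linear_on_def fun_scale_def)
    have 3: "fun_of M (Bang ?E) (Lolli (Bang ?E) ?E) t (g False) \<in> space M (Lolli (Bang ?E) ?E)"
      if "t \<in> space M (bint A)" for t
      using L(2)[OF F(5), of t] that gs by (auto simp: hom_space_def bint)
    have 4: "fun_of M (Bang ?E) ?E t (g True) \<in> space M ?E"
      if "t \<in> space M (Lolli (Bang ?E) ?E)" for t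
      using L(2)[OF F(4), of t] that gs by (auto simp: hom_space_def)
    show ?thesis
      unfolding ev_def
      by (rule linear_on_compose[OF linear_on_compose[OF 1 2] L(1)[OF F(2)]]) (use 3 4 in auto)
  qed
  have combo: "?s c (foldr \<alpha> (rev S) a) + ?s d (foldr \<alpha> (rev T) a) = 0"
    if "?s c (?D S) + ?s d (?D T) = 0" "a \<in> space M A" for c d a
  proof -
    have sub: "V.subspace (space M (bint A))" using subspace_space[OF F(5)] by (simp add: bint)
    have "ev (?s c (?D S) + ?s d (?D T)) a = ?s c (ev (?D S) a) + ?s d (ev (?D T) a)"
      using linear_onD[OF ev_lin] D V.subspace_scale[OF sub] by (simp add: fun_scale_def)
    moreover have "ev 0 a = 0"
      using linear_on_zero[OF vs vector_space_fun_scale[OF vs] sub ev_lin] by simp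
    ultimately show ?thesis using that by (simp add: ev_D)
  qed
  have coeffs: "c = 0 \<and> d = 0" if cd: "?s c (?D S) + ?s d (?D T) = 0" for c d
  proof -
    let ?h = "\<lambda>S. of_nat (horner_sum of_bool 2 (rev S)) :: 'k"
    have x: "?s c (x + ?s (?h S) y) + ?s d (x + ?s (?h T) y) = 0"
      using combo[OF cd xyA(1)] by (simp add: fold_x)
    have y: "?s (c * 2 ^ length S) y + ?s (d * 2 ^ length T) y = 0"
      using combo[OF cd xyA(2)] by (simp add: fold_y)
    have rep0: "rep 0 z = 0" for z by (simp add: rep_def V.representation_zero)
    note reps = rep_add rep_scale rep_basis rep0 xyA V.subspace_scale[OF subA] V.subspace_add[OF subA]
    have cd1: "c + d = 0"
      using arg_cong[OF x, of "\<lambda>v. rep v x"] by (simp add: reps)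
    have cd2: "c * ?h S + d * ?h T = 0"
      using arg_cong[OF x, of "\<lambda>v. rep v y"] by (simp add: reps)
    have cd3: "c * 2 ^ length S + d * 2 ^ length T = 0"
      using arg_cong[OF y, of "\<lambda>v. rep v y"] by (simp add: reps)
    have d: "d = - c" using cd1 by (simp add: eq_neg_iff_add_eq_0 add.commute)
    have "c = 0"
    proof (rule ccontr)
      assume c: "c \<noteq> 0"
      have "(2::'k) ^ length S = 2 ^ length T" using cd3 c by (simp add: d)
      \<comment> \<open>Characteristic zero enters here: \<open>of_nat\<close> is injective, so
        equalities in the field between powers of 2, and below between digit values, descend to
        natural numbers.\<close>
      then have "of_nat (2 ^ length S) = (of_nat (2 ^ length T) :: 'k)" by simp
      then have "(2::nat) ^ length S = 2 ^ length T" by (simp only: of_nat_eq_iff)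
      then have "length S = length T" by simp
      moreover have "?h S = ?h T" using cd2 c by (simp add: d)
      then have "horner_sum of_bool (2 :: nat) (rev S) = horner_sum of_bool 2 (rev T)"
        by (simp only: of_nat_eq_iff)
      ultimately have "rev S = rev T" by (intro horner_sum_of_bool_inject) simp_all
      then show False using distinct by simp
    qed
    with d show ?thesis by simp
  qed
  have ne: "?D S \<noteq> ?D T"
    \<comment> \<open>Equality of the two denotations would be a relation with coefficients 1 and
      -1.\<close>
    using coeffs[of 1 "- 1"] by auto
  have "V.independent {?D S, ?D T}"
  proof -
    have "?D T \<noteq> 0" using coeffs[of 0 1] by auto
    moreover have "?D S \<notin> V.span {?D T}"
    proof
      assume "?D S \<in> V.span {?D T}"
      then obtain k where "?D S = ?s k (?D T)" by (auto simp: V.span_singleton)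
      then show False using coeffs[of 1 "- k"] by simp
    qed
    ultimately show ?thesis using ne by (simp add: V.independent_insert)
  qed
  with D ne show ?thesis by blast
qed

end
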